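(* Let $\sigma>0$, $\mu<0$, $h>0$, and consider the Lindley process with Laplace increments with location $\mu$ and scale $\sigma$. For $n\ge1$ let $h_n=\min\{n,\min_{r>0}\{r(-\mu)>h\}\}$ ($r$ integer) and partition $[0,h)$ into $$I_n^i=[-(i-1)\mu,-i\mu),\quad i=1,\dots,h_n-1,\qquad I_n^{h_n}=[-(h_n-1)\mu,h).$$ Then for $n>0$ and $0\le x<h$ the probability distribution of the first exit time through $h$ is $P(n|x)=\sum_{i=1}^{h_n}P_i(n|x)$, where for $1\le i\le h_n$ $$P_i(n|x)=\Big\{\sum_{j=0}^{n-1}\frac1{2^n\sigma^{n-1}}\big[\alpha_n^{(i,j)}(x+(n-1)\mu)^je^{x/\sigma}+\beta_n^{(i,j)}(x+(n-1)\mu)^je^{-x/\sigma}\big]+\eta_n^i\Big\}\mathbf 1_{I_n^i}(x).$$ The coefficients are defined by the following recursive relations. For $1<i\le h_{n+1}$ and $0<j\le n$, with $I_n^{i^*}$ the interval that contains $\min(x+\mu,h)$ for $x\in I_{n+1}^i$, $$\alpha_{n+1}^{(i,0)}=e^{\mu/\sigma}\Big\{\sum_{j=i^*+1}^{h_n}K_n^j+\sum_{k=0}^{n-1}\Big[\alpha_n^{(i^*,k)}\Big(\frac{((-i^*+n-1)\mu)^{k+1}}{k+1}+k!\frac{\sigma^{k+1}(-1)^k}{2^{k+1}}\Big)-\beta_n^{(i^*,k)}\frac{e^{2(n-1)\mu/\sigma}\sigma^{k+1}}{2^{k+1}}\Gamma\Big(1+k,\frac{2(-i^*+n-1)\mu}\sigma\Big)\Big]-\eta_n^{i^*}(2\sigma)^ne^{i^*\mu/\sigma}\Big\},$$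 $$\alpha_{n+1}^{(i,j)}=-e^{\mu/\sigma}\sum_{k=j-1}^{n-1}\alpha_n^{(i^*,k)}\Big(-\frac\sigma2\Big)^{k-j+1}\frac{k!}{j!},$$ $$\beta_{n+1}^{(i,0)}=e^{-\mu/\sigma}\Big\{\sum_{j=0}^{i^*-1}K_n^j+\sum_{k=0}^{n-1}\Big[-\alpha_n^{(i^*,k)}\frac{e^{-2(n-1)\mu/\sigma}\sigma^{k+1}(-1)^k}{2^{k+1}}\Gamma\Big(1+k,\frac{-2(-i^*+1+n-1)\mu}\sigma\Big)+\beta_n^{(i^*,k)}\Big(-\frac{((-i^*+1+n-1)\mu)^{k+1}}{k+1}+k!\frac{\sigma^{k+1}}{2^{k+1}}\Big)\Big]-\eta_n^{i^*}(2\sigma)^ne^{-(i^*-1)\mu/\sigma}\Big\},$$ $$\beta_{n+1}^{(i,j)}=e^{-\mu/\sigma}\sum_{k=j-1}^{n-1}\beta_n^{(i^*,k)}\Big(\frac\sigma2\Big)^{k-j+1}\frac{k!}{j!},\qquad\eta_{n+1}^i=\eta_n^{i^*}.$$ For $i=1$ (where $i^*$ is taken to be $0$ in the definition of $K_n^j$ below) $$\alpha_{n+1}^{(1,0)}=e^{\mu/\sigma}\Big\{\sum_{j=1}^{h_n}K_n^j-K_n^0\Big\},\quad\alpha_{n+1}^{(1,j)}=0\ (1\le j\le n),\quad\beta_{n+1}^{(1,j)}=0\ (0\le j\le n),\quad\eta_{n+1}^1=\frac{K_n^0}{2^n\sigma^n}.$$ Here $$K_n^0=\sum_{k=0}^{n-1}\sigma\big[\alpha_n^{(1,k)}((n-1)\mu)^k+\beta_n^{(1,k)}((n-1)\mu)^k\big]+(2\sigma)^n\eta_n^1,$$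 for $j=1,\dots,i^*-1$ $$K_n^j=\sum_{k=0}^{n-1}\Big\{\alpha_n^{(j,k)}\frac{e^{-2(n-1)\mu/\sigma}\sigma^{k+1}(-1)^k}{2^{k+1}}\Gamma\Big(1+k,\frac{-2(y+(n-1)\mu)}\sigma\Big)\Big|_{I_n^j}+\beta_n^{(j,k)}\frac{(y+(n-1)\mu)^{k+1}}{k+1}\Big|_{I_n^j}\Big\}+\eta_n^j(2\sigma)^ne^{y/\sigma}\Big|_{I_n^j},$$ and for $j=i^*+1,\dots,h_n$ $$K_n^j=\sum_{k=0}^{n-1}\Big\{\alpha_n^{(j,k)}\frac{(y+(n-1)\mu)^{k+1}}{k+1}\Big|_{I_n^j}-\beta_n^{(j,k)}\frac{e^{2(n-1)\mu/\sigma}\sigma^{k+1}}{2^{k+1}}\Gamma\Big(1+k,\frac{2(y+(n-1)\mu)}\sigma\Big)\Big|_{I_n^j}\Big\}-\eta_n^j(2\sigma)^ne^{-y/\sigma}\Big|_{I_n^j}.$$ The coefficients for the base case of the recursion are $\alpha_1^{(1,0)}=e^{(\mu-h)/\sigma}$, $\beta_1^{(1,0)}=\eta_1^1=0$.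
   Context: Lindley process with Laplace increments: $Z_1,Z_2,\dots$ are i.i.d. real random variables with density $f_Z(z)=\frac{1}{2\sigma}e^{-|z-\mu|/\sigma}$, and $W_0=x\ge0$, $W_n=\max(0,W_{n-1}+Z_n)$ for $n\ge1$. For fixed $h>0$ and $x\in[0,h)$, the first exit time (FET) from $[0,h]$ through $h$ is $N_x=\min\{n>0: W_n\ge h\}$ given $W_0=x$, and $P(n|x)=\mathbb P[N_x=n]$ for integers $n>0$. $\Gamma(m,y)=\int_y^\infty t^{m-1}e^{-t}\,dt$ is the incomplete Gamma function ($m\ge1$ integer, $y$ real). For an interval $I$ with endpoints $p\le q$, $\phi(y)|_I=\phi(q)-\phi(p)$. Empty sums are $0$, and $0^0=1$.
   Formalization: In α_{n+1}^{(i,0)} the three terms evaluated at y = −i*μ are evaluated at the right endpoint of I_n^{i*}, which is h instead of −i*μ when i* = h_n; as printed, the formula already fails for n+1 = 2 when −μ < h. *)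

theory Defs
  imports "HOL-Probability.Probability"
begin

definition laplace_density :: "real \<Rightarrow> real \<Rightarrow> real \<Rightarrow> real" where
  "laplace_density \<mu> \<sigma> z = 1 / (2 * \<sigma>) * exp (- \<bar>z - \<mu>\<bar> / \<sigma>)"

(* The increments are z 1, z 2, ...; the value z 0 is never used. *)
primrec lindley :: "real \<Rightarrow> (nat \<Rightarrow> real) \<Rightarrow> nat \<Rightarrow> real" where
  "lindley x z 0 = x"
| "lindley x z (Suc n) = max 0 (lindley x z n + z (Suc n))"

(* The value is \<infinity> when the level h is never reached. *)
definition first_exit_time :: "real \<Rightarrow> real \<Rightarrow> (nat \<Rightarrow> real) \<Rightarrow> enat" where
  "first_exit_time h x z = (INF n \<in> {n. 0 < n \<and> h \<le> lindley x z n}. enat n)"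

(* Used only for m \<ge> 1; y may be negative. *)
definition inc_Gamma :: "nat \<Rightarrow> real \<Rightarrow> real" where
  "inc_Gamma m y = integral {y..} (\<lambda>t. t ^ (m - 1) * exp (- t))"

context
  fixes \<mu> \<sigma> h :: real
begin

definition hn :: "nat \<Rightarrow> nat" where
  "hn n = min n (LEAST r. 0 < r \<and> h < real r * (- \<mu>))"

definition left_end :: "nat \<Rightarrow> real" where
  "left_end i = - (real i - 1) * \<mu>"

definition right_end :: "nat \<Rightarrow> nat \<Rightarrow> real" where
  "right_end n i = (if i < hn n then - real i * \<mu> else h)"

definition part :: "nat \<Rightarrow> nat \<Rightarrow> real set" where
  "part n i = {left_end i ..< right_end n i}"

(* The increment of \<phi> over the endpoints of the interval part n i. *)
definition over :: "nat \<Rightarrow> nat \<Rightarrow> (real \<Rightarrow> real) \<Rightarrow> real" where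
  "over n i \<phi> = \<phi> (right_end n i) - \<phi> (left_end i)"

(* The index i* attached to the interval number i of the partition at time n + 1, for i > 1.
   It is unspecified if that interval is empty, which happens exactly when h is a multiple
   r * (- \<mu>), n \<ge> r and i = r + 1. The coefficients with that index are then
   irrelevant: their indicator vanishes, and so do all increments over the empty interval. *)
definition istar :: "nat \<Rightarrow> nat \<Rightarrow> nat" where
  "istar n i =
     (THE k. k \<in> {1..hn n} \<and> (\<forall>x \<in> part (Suc n) i. min (x + \<mu>) h \<in> part n k))"

(* The quantity K at time n and index j, when x + \<mu> lies in interval number s (s = 0 stands
   for x + \<mu> < 0); a, b, e are the coefficients alpha, beta, eta at time n.
   It is not used for j = s > 0. *)
definition K ::
  "nat \<Rightarrow> nat \<Rightarrow> (nat \<Rightarrow> nat \<Rightarrow> real) \<Rightarrow> (nat \<Rightarrow> nat \<Rightarrow> real) \<Rightarrow> (nat \<Rightarrow> real) \<Rightarrow> nat \<Rightarrow> real" where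
  "K n s a b e j =
    (if j = 0 then
       (\<Sum>k<n. \<sigma> * (a 1 k * ((real n - 1) * \<mu>) ^ k + b 1 k * ((real n - 1) * \<mu>) ^ k))
         + (2 * \<sigma>) ^ n * e 1
     else if j < s then
       (\<Sum>k<n.
          a j k * over n j (\<lambda>y. exp (- 2 * (real n - 1) * \<mu> / \<sigma>) * \<sigma> ^ (k + 1) * (-1) ^ k / 2 ^ (k + 1)
                             * inc_Gamma (1 + k) (- 2 * (y + (real n - 1) * \<mu>) / \<sigma>))
        + b j k * over n j (\<lambda>y. (y + (real n - 1) * \<mu>) ^ (k + 1) / real (k + 1)))
         + e j * (2 * \<sigma>) ^ n * over n j (\<lambda>y. exp (y / \<sigma>))
     else
       (\<Sum>k<n.
          a j k * over n j (\<lambda>y. (y + (real n - 1) * \<mu>) ^ (k + 1) / real (k + 1))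
        - b j k * over n j (\<lambda>y. exp (2 * (real n - 1) * \<mu> / \<sigma>) * \<sigma> ^ (k + 1) / 2 ^ (k + 1)
                             * inc_Gamma (1 + k) (2 * (y + (real n - 1) * \<mu>) / \<sigma>)))
         - e j * (2 * \<sigma>) ^ n * over n j (\<lambda>y. exp (- y / \<sigma>)))"

(* The arguments are the time n \<ge> 1, the interval i and, for alpha and beta, the power j.
   In alpha at j = 0 the three terms printed with - i* \<mu> are evaluations at the right endpoint
   of interval i* of the partition at time n. That endpoint is - i* \<mu> if i* < hn n, but it
   is h if i* = hn n; with - i* \<mu> in the latter case the distribution would be wrong already
   at n = 2. Hence right_end is used here. *)
fun alpha :: "nat \<Rightarrow> nat \<Rightarrow> nat \<Rightarrow> real"
  and beta :: "nat \<Rightarrow> nat \<Rightarrow> nat \<Rightarrow> real"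
  and eta :: "nat \<Rightarrow> nat \<Rightarrow> real" where
  "alpha 0 i j = 0"
| "alpha (Suc n) i j =
    (if n = 0 then (if i = 1 \<and> j = 0 then exp ((\<mu> - h) / \<sigma>) else 0)
     else if i = 1 then
       (if j = 0 then
          exp (\<mu> / \<sigma>) * ((\<Sum>l=1..hn n. K n 0 (alpha n) (beta n) (eta n) l)
                          - K n 0 (alpha n) (beta n) (eta n) 0)
        else 0)
     else
       (let s = istar n i in
        if j = 0 then
          exp (\<mu> / \<sigma>) *
            ((\<Sum>l=s+1..hn n. K n s (alpha n) (beta n) (eta n) l)
             + (\<Sum>k<n.
                  alpha n s k * ((right_end n s + (real n - 1) * \<mu>) ^ (k + 1) / real (k + 1)
                                 + fact k * \<sigma> ^ (k + 1) * (-1) ^ k / 2 ^ (k + 1))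
                - beta n s k * (exp (2 * (real n - 1) * \<mu> / \<sigma>) * \<sigma> ^ (k + 1) / 2 ^ (k + 1))
                    * inc_Gamma (1 + k) (2 * (right_end n s + (real n - 1) * \<mu>) / \<sigma>))
             - eta n s * (2 * \<sigma>) ^ n * exp (- right_end n s / \<sigma>))
        else
          - exp (\<mu> / \<sigma>) *
            (\<Sum>k=j-1..n-1. alpha n s k * (- \<sigma> / 2) ^ (k + 1 - j) * (fact k / fact j))))"
| "beta 0 i j = 0"
| "beta (Suc n) i j =
    (if n = 0 then 0
     else if i = 1 then 0
     else
       (let s = istar n i in
        if j = 0 then
          exp (- \<mu> / \<sigma>) *
            ((\<Sum>l<s. K n s (alpha n) (beta n) (eta n) l)
             + (\<Sum>k<n.
                  - alpha n s k * (exp (- 2 * (real n - 1) * \<mu> / \<sigma>) * \<sigma> ^ (k + 1) * (-1) ^ k / 2 ^ (k + 1))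
                    * inc_Gamma (1 + k) (- 2 * ((- real s + 1 + real n - 1) * \<mu>) / \<sigma>)
                + beta n s k * (- (((- real s + 1 + real n - 1) * \<mu>) ^ (k + 1) / real (k + 1))
                                + fact k * \<sigma> ^ (k + 1) / 2 ^ (k + 1)))
             - eta n s * (2 * \<sigma>) ^ n * exp (- (real s - 1) * \<mu> / \<sigma>))
        else
          exp (- \<mu> / \<sigma>) *
            (\<Sum>k=j-1..n-1. beta n s k * (\<sigma> / 2) ^ (k + 1 - j) * (fact k / fact j))))"
| "eta 0 i = 0"
| "eta (Suc n) i =
    (if n = 0 then 0
     else if i = 1 then K n 0 (alpha n) (beta n) (eta n) 0 / (2 ^ n * \<sigma> ^ n)
     else eta n (istar n i))"

definition P_piece :: "nat \<Rightarrow> nat \<Rightarrow> real \<Rightarrow> real" where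
  "P_piece n i x =
    ((\<Sum>j<n. 1 / (2 ^ n * \<sigma> ^ (n - 1)) *
        (alpha n i j * (x + (real n - 1) * \<mu>) ^ j * exp (x / \<sigma>)
         + beta n i j * (x + (real n - 1) * \<mu>) ^ j * exp (- x / \<sigma>)))
      + eta n i) * indicator (part n i) x"

end

end

theory Submission
  imports Defs
begin

text \<open>
  Write \<open>f\<close> for the Laplace density, \<open>F\<close> for its distribution function and \<open>P(n|x)\<close> for the law of
  the first exit time. Conditioning on the first increment gives the one-step equation
  \<open>P(n+1|x) = F(-x) P(n|0) + \<integral>\<^sub>0\<^sup>h f(y - x) P(n|y) dy\<close>: the first step leads to \<open>0\<close> with
  probability \<open>F(-x)\<close>, and otherwise to a point \<open>y > 0\<close> with density \<open>f(y - x)\<close>. This is the step in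
  the induction for \<open>first_exit_law\<close>. That the closed formula solves this equation
  is \<open>exit_prob_Suc\<close>, and the start \<open>n = 1\<close> is \<open>exit_prob_1\<close>.

  Put \<open>t = x + \<mu>\<close>, so that \<open>f(y - x) = exp (- \<bar>y - t\<bar> / \<sigma>) / (2 \<sigma>)\<close>. On a cell of the partition the
  formula for \<open>P(n|y)\<close> is a polynomial in \<open>y + (n - 1) \<mu>\<close> times \<open>exp (y / \<sigma>)\<close>, plus one times
  \<open>exp (- y / \<sigma>)\<close>, plus a constant. On a cell to the right of \<open>t\<close> the integrand is \<open>exp (t / \<sigma>)\<close>
  times a function of \<open>y\<close> whose primitive \<open>upper_prim\<close> involves powers and incomplete Gamma
  functions. On a cell to the left of \<open>t\<close> it is \<open>exp (- t / \<sigma>)\<close> times a function with the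
  primitive \<open>lower_prim\<close>. The quantities \<open>K\<close> of positive index are the increments of these
  primitives over the cells, and the quantity of index \<open>0\<close> carries the mass that the first
  step puts on \<open>0\<close>. As these terms depend on \<open>x\<close> only through \<open>exp (t / \<sigma>)\<close> and \<open>exp (- t / \<sigma>)\<close>, they
  enter the coefficients of power \<open>0\<close>.

  The cell that contains \<open>t\<close> is cut at \<open>t\<close> and leaves the term
  \<open>exp (- t / \<sigma>) lower_prim(t) - exp (t / \<sigma>) upper_prim(t)\<close>. As
  \<open>\<Gamma>(k + 1, y) = k! exp (- y) (\<Sum>j\<le>k. y\<^sup>j / j!)\<close>, the exponentials recombine and this term is again
  of the same shape, with powers of \<open>t + (n - 1) \<mu> = x + n \<mu>\<close>. That is \<open>prim_difference\<close>, and it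
  produces the recursion for the coefficients of positive power and the factorial terms in those
  of power \<open>0\<close>. On the first cell \<open>t\<close> is negative: every cell is to its right, no
  cell is cut, and \<open>F(-x) = 1 - exp (t / \<sigma>) / 2\<close> contributes the constant \<open>\<eta>\<close>.

  The translation by \<open>\<mu>\<close> maps cell \<open>i > 1\<close> at time \<open>n + 1\<close> into cell \<open>i - 1\<close> at time \<open>n\<close>
  (\<open>part_shift\<close>), so that \<open>i\<^sup>* = i - 1\<close> whenever cell \<open>i\<close> is not empty.
\<close>

section \<open>The incomplete Gamma function and exponential integrals\<close>

definition exp_partial_sum :: "nat \<Rightarrow> real \<Rightarrow> real" where
  "exp_partial_sum k t = (\<Sum>j\<le>k. t ^ j / fact j)"

lemma exp_partial_sum_deriv:
  "(exp_partial_sum k has_real_derivative exp_partial_sum k t - t ^ k / fact k) (at t)"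
proof (induction k)
  case 0
  show ?case by (auto simp: exp_partial_sum_def[abs_def])
next
  case (Suc k)
  have eq: "exp_partial_sum (Suc k) = (\<lambda>t. exp_partial_sum k t + t ^ Suc k / fact (Suc k))"
    by (auto simp: exp_partial_sum_def)
  have "((\<lambda>t. t ^ Suc k / fact (Suc k)) has_real_derivative t ^ k / fact k) (at t)"
  proof -
    have "((\<lambda>t. t ^ Suc k / fact (Suc k)) has_real_derivative
        (real (Suc k) * t ^ k) / fact (Suc k)) (at t)"
      by (rule DERIV_cdivide) (use DERIV_pow[of "Suc k" t] in simp)
    moreover have "(real (Suc k) * t ^ k) / fact (Suc k) = t ^ k / fact k"
      by (simp add: divide_simps del: of_nat_Suc)
    ultimately show ?thesis by (simp only:)
  qed
  from DERIV_add[OF Suc.IH this] show ?case unfolding eq by simp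
qed

text \<open>In the derivative of \<open>exp (- t) * exp_partial_sum k t\<close> everything telescopes but the top term.\<close>
lemma exp_partial_sum_exp_deriv:
  "((\<lambda>t. - (fact k * exp (- t) * exp_partial_sum k t)) has_real_derivative t ^ k * exp (- t)) (at t)"
  by (rule derivative_eq_intros exp_partial_sum_deriv refl | simp)+
     (simp add: algebra_simps)

lemma exp_partial_sum_exp_tendsto_0: "((\<lambda>t. exp (- t) * exp_partial_sum k t) \<longlongrightarrow> 0) at_top"
proof -
  have "((\<lambda>t::real. \<Sum>j\<le>k. t ^ j / exp t / fact j) \<longlongrightarrow> (\<Sum>j\<le>k. 0 / fact j)) at_top"
    by (intro tendsto_intros tendsto_power_div_exp_0) simp
  then show ?thesis
    by (simp add: exp_partial_sum_def sum_distrib_left exp_minus field_simps)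
qed

lemma has_integral_power_exp:
  assumes "a \<le> b"
  shows "((\<lambda>t. t ^ k * exp (- t)) has_integral
     fact k * exp (- a) * exp_partial_sum k a - fact k * exp (- b) * exp_partial_sum k b) {a..b}"
  using fundamental_theorem_of_calculus[OF assms, of "\<lambda>t. - (fact k * exp (- t) * exp_partial_sum k t)"
     "\<lambda>t. t ^ k * exp (- t)"]
  by (auto simp: has_real_derivative_iff_has_vector_derivative[symmetric]
      intro: DERIV_subset[OF exp_partial_sum_exp_deriv])

text \<open>
  For negative \<open>y\<close> the integrand may change sign, so the integral is split at \<open>0\<close>: on \<open>[0, \<infinity>)\<close> the
  integrand is nonnegative and the improper integral is a monotone limit, on \<open>[y, 0]\<close> the
  fundamental theorem applies.
\<close>
lemma inc_Gamma_closed_form: "inc_Gamma (Suc k) y = fact k * exp (- y) * exp_partial_sum k y"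
proof -
  let ?f = "\<lambda>t::real. t ^ k * exp (- t)" and ?G = "\<lambda>t. fact k * exp (- t) * exp_partial_sum k t"
  have nonneg: "(?f has_integral ?G a) {a..}" if "0 \<le> a" for a
  proof (rule has_integral_to_inf)
    show "?f integrable_on {a..y}" for y
      by (intro integrable_continuous_interval continuous_intros)
    have "((\<lambda>y. ?G a - fact k * (exp (- y) * exp_partial_sum k y)) \<longlongrightarrow> ?G a - fact k * 0) at_top"
      by (intro tendsto_intros exp_partial_sum_exp_tendsto_0)
    moreover have "\<forall>\<^sub>F y in at_top. ?G a - fact k * (exp (- y) * exp_partial_sum k y) = integral {a..y} ?f"
      using eventually_ge_at_top[of a]
    proof eventually_elim
      case (elim y)
      then show ?case
        using integral_unique[OF has_integral_power_exp[OF elim, of k]] by (simp add: mult.assoc)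
    qed
    ultimately show "((\<lambda>y. integral {a..y} ?f) \<longlongrightarrow> ?G a) at_top"
      by (auto elim: Lim_transform_eventually)
    show "?f y \<ge> 0" if "y \<ge> a" for y using that \<open>0 \<le> a\<close> by simp
  qed
  have "(?f has_integral ?G y) {y..}"
  proof (cases "0 \<le> y")
    case False
    then have "(?f has_integral (?G y - ?G 0) + ?G 0) ({y..0} \<union> {0..})"
      by (intro has_integral_Un has_integral_power_exp nonneg) (auto simp: atLeast_def atMost_def
        intro: negligible_subset[of "{0}"])
    moreover have "{y..0} \<union> {0..} = {y..}" using False by auto
    ultimately show ?thesis by (simp add: algebra_simps)
  qed (rule nonneg)
  then show ?thesis by (simp add: inc_Gamma_def integral_unique)
qed

lemma inc_Gamma_deriv: "(inc_Gamma (Suc k) has_real_derivative - (t ^ k * exp (- t))) (at t)"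
  using DERIV_minus[OF exp_partial_sum_exp_deriv[of k t]]
  unfolding inc_Gamma_closed_form[abs_def] by simp

text \<open>
  The reflection of \<open>has_integral_exp_minus_to_infinity\<close>. It passes through the Lebesgue integral,
  where a change of variables on an unbounded domain is at hand.
\<close>
lemma has_integral_exp_Iic:
  fixes a :: real
  assumes a: "0 < a"
  shows "((\<lambda>x. exp (a * x)) has_integral exp (a * c) / a) {..c}"
proof -
  have "(\<integral>\<^sup>+x. ennreal (exp (- a * x)) * indicator {- c..} x \<partial>lborel) = ennreal (exp (a * c) / a)"
    using nn_integral_has_integral_lebesgue'[OF _ has_integral_exp_minus_to_infinity[OF a, of "- c"]]
    by simp
  also have "(\<integral>\<^sup>+x. ennreal (exp (- a * x)) * indicator {- c..} x \<partial>lborel)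
      = (\<integral>\<^sup>+x. ennreal (exp (a * x)) * indicator {..c} x \<partial>lborel)"
    by (subst nn_integral_real_affine[where c="-1" and t=0])
       (auto intro!: nn_integral_cong simp: indicator_def)
  also have "\<dots> = (\<integral>\<^sup>+x. ennreal (exp (a * x) * indicator {..c} x) \<partial>lborel)"
    by (auto intro!: nn_integral_cong simp: indicator_def)
  finally have "((\<lambda>x. exp (a * x) * indicator {..c} x) has_integral exp (a * c) / a) UNIV"
    using a by (intro nn_integral_has_integral) auto
  then show ?thesis
    by (subst has_integral_restrict_UNIV[symmetric]) (simp add: indicator_def of_bool_def if_distrib cong: if_cong)
qed

section \<open>Exponential polynomials and their weighted primitives\<close>

text \<open>The shape of \<open>P(n|y)\<close> on one cell, with the normalization of \<open>P_piece\<close>.\<close>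
definition quasi_poly ::
  "real \<Rightarrow> real \<Rightarrow> nat \<Rightarrow> (nat \<Rightarrow> real) \<Rightarrow> (nat \<Rightarrow> real) \<Rightarrow> real \<Rightarrow> real \<Rightarrow> real" where
  "quasi_poly \<mu> \<sigma> n a b e y =
     (\<Sum>j<n. 1 / (2 ^ n * \<sigma> ^ (n - 1)) *
        (a j * (y + (real n - 1) * \<mu>) ^ j * exp (y / \<sigma>)
         + b j * (y + (real n - 1) * \<mu>) ^ j * exp (- y / \<sigma>))) + e"

text \<open>
  Up to the factor \<open>2\<^sup>n \<sigma>\<^sup>n\<^sup>-\<^sup>1\<close>, \<open>upper_prim\<close> and \<open>lower_prim\<close> are primitives of \<open>quasi_poly\<close> times
  \<open>exp (- y / \<sigma>)\<close> and \<open>exp (y / \<sigma>)\<close>. Their constants of integration and their form follow the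
  definition of \<open>K\<close>, so that the values of \<open>K\<close> are increments of these functions.
\<close>
definition upper_prim ::
  "real \<Rightarrow> real \<Rightarrow> nat \<Rightarrow> (nat \<Rightarrow> real) \<Rightarrow> (nat \<Rightarrow> real) \<Rightarrow> real \<Rightarrow> real \<Rightarrow> real" where
  "upper_prim \<mu> \<sigma> n a b e y =
     (\<Sum>k<n.
        a k * ((y + (real n - 1) * \<mu>) ^ (k + 1) / real (k + 1))
      - b k * (exp (2 * (real n - 1) * \<mu> / \<sigma>) * \<sigma> ^ (k + 1) / 2 ^ (k + 1)
               * inc_Gamma (1 + k) (2 * (y + (real n - 1) * \<mu>) / \<sigma>)))
     - e * (2 * \<sigma>) ^ n * exp (- y / \<sigma>)"

definition lower_prim ::
  "real \<Rightarrow> real \<Rightarrow> nat \<Rightarrow> (nat \<Rightarrow> real) \<Rightarrow> (nat \<Rightarrow> real) \<Rightarrow> real \<Rightarrow> real \<Rightarrow> real" where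
  "lower_prim \<mu> \<sigma> n a b e y =
     (\<Sum>k<n.
        a k * (exp (- 2 * (real n - 1) * \<mu> / \<sigma>) * \<sigma> ^ (k + 1) * (-1) ^ k / 2 ^ (k + 1)
               * inc_Gamma (1 + k) (- 2 * (y + (real n - 1) * \<mu>) / \<sigma>))
      + b k * ((y + (real n - 1) * \<mu>) ^ (k + 1) / real (k + 1)))
     + e * (2 * \<sigma>) ^ n * exp (y / \<sigma>)"

lemma quasi_poly_scaled:
  assumes "\<sigma> > 0"
  shows "2 ^ n * \<sigma> ^ (n - 1) * quasi_poly \<mu> \<sigma> n a b e y =
     (\<Sum>j<n. a j * (y + (real n - 1) * \<mu>) ^ j * exp (y / \<sigma>)
           + b j * (y + (real n - 1) * \<mu>) ^ j * exp (- y / \<sigma>))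
     + 2 ^ n * \<sigma> ^ (n - 1) * e"
proof -
  have "D * (1 / D * S + e) = S + D * e" if "D \<noteq> 0" for D S :: real
    using that by (simp add: field_simps)
  then show ?thesis
    unfolding quasi_poly_def sum_distrib_left[symmetric] using assms by simp
qed

lemma shifted_power_deriv:
  "((\<lambda>y. (y + c) ^ (k + 1) / real (k + 1)) has_real_derivative (y + c) ^ k) (at y)"
proof -
  have "((\<lambda>y. (y + c) ^ (k + 1) / real (k + 1)) has_real_derivative
      real (k + 1) * (y + c) ^ k / real (k + 1)) (at y)"
    by (rule derivative_eq_intros refl | simp)+
  then show ?thesis by (simp del: of_nat_add)
qed

lemma scaled_inc_Gamma_deriv:
  fixes r :: real
  assumes "r \<noteq> 0"
  shows "((\<lambda>y. inc_Gamma (1 + k) (r * (y + c))) has_real_derivative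
     - (r ^ (k + 1) * (y + c) ^ k * exp (- (r * (y + c))))) (at y)"
proof -
  have "((\<lambda>y. inc_Gamma (Suc k) (r * (y + c))) has_real_derivative
     - ((r * (y + c)) ^ k * exp (- (r * (y + c)))) * r) (at y)"
    by (rule DERIV_chain2[OF inc_Gamma_deriv]) (rule derivative_eq_intros refl | simp)+
  then show ?thesis by (simp add: power_mult_distrib mult_ac)
qed

lemma cancel_constants:
  fixes A E X S R P :: real
  assumes "A * E = X" "S * R = 1"
  shows "A * S * - (R * P * E) = - (P * X)"
proof -
  have "A * S * - (R * P * E) = - (P * (A * E) * (S * R))" by (simp add: mult_ac)
  then show ?thesis using assms by simp
qed

text \<open>
  Against \<open>exp (- y / \<sigma>)\<close> the \<open>a\<close>-terms lose their exponential and are integrated as powers. The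
  \<open>b\<close>-terms keep the weight \<open>exp (- 2 y / \<sigma>)\<close>, and their primitive is an incomplete Gamma function
  at \<open>2 (y + c) / \<sigma>\<close> after compensation by \<open>exp (2 c / \<sigma>)\<close>, where \<open>c = (n - 1) \<mu>\<close>.
\<close>
lemma upper_prim_deriv:
  assumes "\<sigma> > 0" "n > 0"
  shows "(upper_prim \<mu> \<sigma> n a b e has_real_derivative
     2 ^ n * \<sigma> ^ (n - 1) * exp (- y / \<sigma>) * quasi_poly \<mu> \<sigma> n a b e y) (at y)"
proof -
  define c where "c = (real n - 1) * \<mu>"
  have G: "((\<lambda>y. exp (2 * (real n - 1) * \<mu> / \<sigma>) * \<sigma> ^ (k + 1) / 2 ^ (k + 1)
               * inc_Gamma (1 + k) (2 * (y + c) / \<sigma>)) has_real_derivative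
          - ((y + c) ^ k * exp (- (2 * y / \<sigma>)))) (at y)" for k
  proof -
    have "((\<lambda>y. exp (2 * (real n - 1) * \<mu> / \<sigma>) * (\<sigma> ^ (k + 1) / 2 ^ (k + 1))
               * inc_Gamma (1 + k) (2 / \<sigma> * (y + c))) has_real_derivative
        exp (2 * (real n - 1) * \<mu> / \<sigma>) * (\<sigma> ^ (k + 1) / 2 ^ (k + 1)) *
          - ((2 / \<sigma>) ^ (k + 1) * (y + c) ^ k * exp (- (2 / \<sigma> * (y + c))))) (at y)"
      using assms by (intro DERIV_cmult scaled_inc_Gamma_deriv) simp
    moreover have "exp (2 * (real n - 1) * \<mu> / \<sigma>) * exp (- (2 / \<sigma> * (y + c))) = exp (- (2 * y / \<sigma>))"
      using assms by (simp add: exp_add[symmetric] c_def field_simps)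
    moreover have "\<sigma> ^ (k + 1) / 2 ^ (k + 1) * (2 / \<sigma>) ^ (k + 1) = 1"
      using assms by (simp add: power_divide)
    ultimately show ?thesis
      by (simp only: cancel_constants) (simp only: times_divide_eq_left times_divide_eq_right)
  qed
  have E: "((\<lambda>y. e * (2 * \<sigma>) ^ n * exp (- y / \<sigma>)) has_real_derivative
     - (2 ^ n * \<sigma> ^ (n - 1) * exp (- y / \<sigma>) * e)) (at y)"
    using assms by (cases n) ((rule derivative_eq_intros refl | simp add: power_mult_distrib)+)
  have "(upper_prim \<mu> \<sigma> n a b e has_real_derivative
     (\<Sum>k<n. a k * (y + c) ^ k - b k * - ((y + c) ^ k * exp (- (2 * y / \<sigma>))))
     - - (2 ^ n * \<sigma> ^ (n - 1) * exp (- y / \<sigma>) * e)) (at y)"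
    unfolding upper_prim_def[abs_def] c_def[symmetric]
    by (intro DERIV_diff DERIV_sum DERIV_cmult shifted_power_deriv G E)
  moreover have ee: "exp (- y / \<sigma>) * exp (y / \<sigma>) = 1"
    "exp (- y / \<sigma>) * exp (- y / \<sigma>) = exp (- (2 * y / \<sigma>))"
    by (simp_all add: exp_add[symmetric])
  have "exp (- y / \<sigma>) * (a k * (y + c) ^ k * exp (y / \<sigma>) + b k * (y + c) ^ k * exp (- y / \<sigma>))
     = a k * (y + c) ^ k - b k * - ((y + c) ^ k * exp (- (2 * y / \<sigma>)))" for k
  proof -
    have "exp (- y / \<sigma>) * (a k * (y + c) ^ k * exp (y / \<sigma>) + b k * (y + c) ^ k * exp (- y / \<sigma>))
       = a k * (y + c) ^ k * (exp (- y / \<sigma>) * exp (y / \<sigma>))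
       + b k * (y + c) ^ k * (exp (- y / \<sigma>) * exp (- y / \<sigma>))"
      by (simp only: algebra_simps)
    then show ?thesis unfolding ee by simp
  qed
  then have "(\<Sum>k<n. exp (- y / \<sigma>) * (a k * (y + c) ^ k * exp (y / \<sigma>) + b k * (y + c) ^ k * exp (- y / \<sigma>)))
     + 2 ^ n * \<sigma> ^ (n - 1) * exp (- y / \<sigma>) * e = (\<Sum>k<n. a k * (y + c) ^ k - b k * - ((y + c) ^ k * exp (- (2 * y / \<sigma>))))
     - - (2 ^ n * \<sigma> ^ (n - 1) * exp (- y / \<sigma>) * e)"
    by simp
  moreover have "2 ^ n * \<sigma> ^ (n - 1) * exp (- y / \<sigma>) * quasi_poly \<mu> \<sigma> n a b e y
    = exp (- y / \<sigma>) * (\<Sum>k<n. a k * (y + c) ^ k * exp (y / \<sigma>) + b k * (y + c) ^ k * exp (- y / \<sigma>))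
     + 2 ^ n * \<sigma> ^ (n - 1) * exp (- y / \<sigma>) * e"
    using arg_cong[OF quasi_poly_scaled[OF assms(1), of n \<mu> a b e y, folded c_def],
        of "\<lambda>z. exp (- y / \<sigma>) * z"]
    unfolding distrib_left[of "exp (- y / \<sigma>)" "sum _ _"] by (simp only: mult_ac)
  ultimately show ?thesis by (simp only: sum_distrib_left)
qed

text \<open>
  Here the roles of \<open>a\<close> and \<open>b\<close> are exchanged. The incomplete Gamma function is taken at
  \<open>- 2 (y + c) / \<sigma>\<close>, which explains the signs \<open>(-1)\<^sup>k\<close>.
\<close>
lemma lower_prim_deriv:
  assumes "\<sigma> > 0" "n > 0"
  shows "(lower_prim \<mu> \<sigma> n a b e has_real_derivative
     2 ^ n * \<sigma> ^ (n - 1) * exp (y / \<sigma>) * quasi_poly \<mu> \<sigma> n a b e y) (at y)"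
proof -
  define c where "c = (real n - 1) * \<mu>"
  have G: "((\<lambda>y. exp (- 2 * (real n - 1) * \<mu> / \<sigma>) * \<sigma> ^ (k + 1) * (-1) ^ k / 2 ^ (k + 1)
               * inc_Gamma (1 + k) (- 2 * (y + c) / \<sigma>)) has_real_derivative
          (y + c) ^ k * exp (2 * y / \<sigma>)) (at y)" for k
  proof -
    have "((\<lambda>y. exp (- 2 * (real n - 1) * \<mu> / \<sigma>) * (- (\<sigma> ^ (k + 1) * (-1) ^ k / 2 ^ (k + 1)))
               * inc_Gamma (1 + k) (- 2 / \<sigma> * (y + c))) has_real_derivative
        exp (- 2 * (real n - 1) * \<mu> / \<sigma>) * (- (\<sigma> ^ (k + 1) * (-1) ^ k / 2 ^ (k + 1))) *
          - ((- 2 / \<sigma>) ^ (k + 1) * (y + c) ^ k * exp (- (- 2 / \<sigma> * (y + c))))) (at y)"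
      using assms by (intro DERIV_cmult scaled_inc_Gamma_deriv) simp
    moreover have "exp (- 2 * (real n - 1) * \<mu> / \<sigma>) * exp (- (- 2 / \<sigma> * (y + c))) = exp (2 * y / \<sigma>)"
      using assms by (simp add: exp_add[symmetric] c_def field_simps)
    moreover have "- (\<sigma> ^ (k + 1) * (-1) ^ k / 2 ^ (k + 1)) * (- 2 / \<sigma>) ^ (k + 1) = 1"
    proof -
      have "(- 2 / \<sigma>) ^ (k + 1) = (-1) ^ (k + 1) * (2 / \<sigma>) ^ (k + 1)"
        by (subst power_mult_distrib[symmetric]) simp
      then show ?thesis using assms by (simp add: power_divide power_add[symmetric])
    qed
    ultimately have "((\<lambda>y. exp (- 2 * (real n - 1) * \<mu> / \<sigma>) * (- (\<sigma> ^ (k + 1) * (-1) ^ k / 2 ^ (k + 1)))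
               * inc_Gamma (1 + k) (- 2 / \<sigma> * (y + c))) has_real_derivative
          - ((y + c) ^ k * exp (2 * y / \<sigma>))) (at y)"
      by (simp only: cancel_constants)
    from DERIV_minus[OF this] show ?thesis
      by (simp only: times_divide_eq_left times_divide_eq_right mult_minus_left mult_minus_right
          minus_minus mult.assoc)
  qed
  have E: "((\<lambda>y. e * (2 * \<sigma>) ^ n * exp (y / \<sigma>)) has_real_derivative
     2 ^ n * \<sigma> ^ (n - 1) * exp (y / \<sigma>) * e) (at y)"
    using assms by (cases n) ((rule derivative_eq_intros refl | simp add: power_mult_distrib)+)
  have "(lower_prim \<mu> \<sigma> n a b e has_real_derivative
     (\<Sum>k<n. a k * ((y + c) ^ k * exp (2 * y / \<sigma>)) + b k * (y + c) ^ k)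
     + 2 ^ n * \<sigma> ^ (n - 1) * exp (y / \<sigma>) * e) (at y)"
    unfolding lower_prim_def[abs_def] c_def[symmetric]
    by (intro DERIV_add DERIV_sum DERIV_cmult shifted_power_deriv G E)
  moreover have ee: "exp (y / \<sigma>) * exp (- y / \<sigma>) = 1"
    "exp (y / \<sigma>) * exp (y / \<sigma>) = exp (2 * y / \<sigma>)"
    by (simp_all add: exp_add[symmetric])
  have "exp (y / \<sigma>) * (a k * (y + c) ^ k * exp (y / \<sigma>) + b k * (y + c) ^ k * exp (- y / \<sigma>))
     = a k * ((y + c) ^ k * exp (2 * y / \<sigma>)) + b k * (y + c) ^ k" for k
  proof -
    have "exp (y / \<sigma>) * (a k * (y + c) ^ k * exp (y / \<sigma>) + b k * (y + c) ^ k * exp (- y / \<sigma>))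
       = a k * (y + c) ^ k * (exp (y / \<sigma>) * exp (y / \<sigma>))
       + b k * (y + c) ^ k * (exp (y / \<sigma>) * exp (- y / \<sigma>))"
      by (simp only: algebra_simps)
    then show ?thesis unfolding ee by simp
  qed
  then have "(\<Sum>k<n. exp (y / \<sigma>) * (a k * (y + c) ^ k * exp (y / \<sigma>) + b k * (y + c) ^ k * exp (- y / \<sigma>)))
     + 2 ^ n * \<sigma> ^ (n - 1) * exp (y / \<sigma>) * e = (\<Sum>k<n. a k * ((y + c) ^ k * exp (2 * y / \<sigma>)) + b k * (y + c) ^ k)
     + 2 ^ n * \<sigma> ^ (n - 1) * exp (y / \<sigma>) * e"
    by simp
  moreover have "2 ^ n * \<sigma> ^ (n - 1) * exp (y / \<sigma>) * quasi_poly \<mu> \<sigma> n a b e y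
    = exp (y / \<sigma>) * (\<Sum>k<n. a k * (y + c) ^ k * exp (y / \<sigma>) + b k * (y + c) ^ k * exp (- y / \<sigma>))
     + 2 ^ n * \<sigma> ^ (n - 1) * exp (y / \<sigma>) * e"
    using arg_cong[OF quasi_poly_scaled[OF assms(1), of n \<mu> a b e y, folded c_def],
        of "\<lambda>z. exp (y / \<sigma>) * z"]
    unfolding distrib_left[of "exp (y / \<sigma>)" "sum _ _"] by (simp only: mult_ac)
  ultimately show ?thesis by (simp only: sum_distrib_left)
qed

text \<open>
  The parts of the recursions for \<open>\<alpha>\<close> and \<open>\<beta>\<close> that come from the point where a cell is cut,
  without the factors \<open>exp (\<mu> / \<sigma>)\<close> and \<open>exp (- \<mu> / \<sigma>)\<close>. Natural subtraction gives \<open>0 - 1 = 0\<close>, so for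
  \<open>j = 0\<close> the sum runs over all \<open>k < n\<close>, as it must.
\<close>
definition alpha_shift :: "real \<Rightarrow> nat \<Rightarrow> (nat \<Rightarrow> real) \<Rightarrow> nat \<Rightarrow> real" where
  "alpha_shift \<sigma> n a j = - (\<Sum>k=j-1..n-1. a k * (- \<sigma> / 2) ^ (k + 1 - j) * (fact k / fact j))"

definition beta_shift :: "real \<Rightarrow> nat \<Rightarrow> (nat \<Rightarrow> real) \<Rightarrow> nat \<Rightarrow> real" where
  "beta_shift \<sigma> n b j = (\<Sum>k=j-1..n-1. b k * (\<sigma> / 2) ^ (k + 1 - j) * (fact k / fact j))"

text \<open>Exchange of the order of summation: the coefficient of \<open>v\<^sup>j\<close> collects the indices \<open>k \<ge> j - 1\<close>.\<close>
lemma beta_shift_sum: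
  assumes "n > 0"
  shows "(\<Sum>j\<le>n. beta_shift \<sigma> n b j * v ^ j) =
    (\<Sum>k<n. b k * (\<Sum>j\<le>k+1. (\<sigma> / 2) ^ (k + 1 - j) * (fact k / fact j) * v ^ j))"
proof -
  let ?c = "\<lambda>k j. b k * ((\<sigma> / 2) ^ (k + 1 - j) * (fact k / fact j) * v ^ j)"
  have "(\<Sum>k<n. b k * (\<Sum>j\<le>k+1. (\<sigma> / 2) ^ (k + 1 - j) * (fact k / fact j) * v ^ j))
      = (\<Sum>k<n. \<Sum>j\<le>k+1. ?c k j)"
    by (simp only: sum_distrib_left)
  also have "\<dots> = (\<Sum>k\<in>{..<n}. \<Sum>j | j \<in> {..n} \<and> j \<le> k + 1. ?c k j)"
    by (intro sum.cong refl) auto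
  also have "\<dots> = (\<Sum>j\<in>{..n}. \<Sum>k | k \<in> {..<n} \<and> j \<le> k + 1. ?c k j)"
    by (rule sum.swap_restrict) auto
  also have "\<dots> = (\<Sum>j\<le>n. \<Sum>k=j-1..n-1. ?c k j)"
    using assms by (intro sum.cong refl) auto
  also have "\<dots> = (\<Sum>j\<le>n. beta_shift \<sigma> n b j * v ^ j)"
    by (simp only: beta_shift_def sum_distrib_right mult.assoc)
  finally show ?thesis by simp
qed

text \<open>This reduces the statements on \<open>\<alpha>\<close> to those on \<open>\<beta>\<close>, with \<open>- \<sigma>\<close> for \<open>\<sigma>\<close>.\<close>
lemma alpha_shift_eq: "alpha_shift \<sigma> n a j = - beta_shift (- \<sigma>) n a j"
  by (simp add: alpha_shift_def beta_shift_def)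

lemma divide_swap: "a / b / c = a / c / (b :: real)"
  by simp

lemma inc_Gamma_expand:
  fixes r :: real
  assumes "r \<noteq> 0"
  shows "inc_Gamma (1 + k) (r * v) / r ^ (k + 1) =
    exp (- (r * v)) * (\<Sum>j\<le>k. (1 / r) ^ (k + 1 - j) * (fact k / fact j) * v ^ j)"
proof -
  have "(r * v) ^ j / r ^ (k + 1) = (1 / r) ^ (k + 1 - j) * v ^ j" if "j \<le> k" for j
  proof -
    have "r ^ (k + 1) = r ^ j * r ^ (k + 1 - j)"
      using that by (simp add: power_add[symmetric])
    then show ?thesis using assms by (simp add: power_mult_distrib power_divide)
  qed
  then have E: "exp_partial_sum k (r * v) / r ^ (k + 1)
      = (\<Sum>j\<le>k. (1 / r) ^ (k + 1 - j) * v ^ j / fact j)"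
    unfolding exp_partial_sum_def sum_divide_distrib
    using divide_swap[of _ "fact _"] by (intro sum.cong refl) (simp only: atMost_iff)
  have I: "inc_Gamma (1 + k) (r * v) = fact k * exp (- (r * v)) * exp_partial_sum k (r * v)"
    using inc_Gamma_closed_form[of k "r * v"] by simp
  have "inc_Gamma (1 + k) (r * v) / r ^ (k + 1)
      = fact k * exp (- (r * v)) * (\<Sum>j\<le>k. (1 / r) ^ (k + 1 - j) * v ^ j / fact j)"
    unfolding I times_divide_eq_right[symmetric] E ..
  then show ?thesis by (simp add: sum_distrib_left mult_ac)
qed

text \<open>
  The step that makes the recursion close. With \<open>N = exp (- t / \<sigma>)\<close> and \<open>P = exp (t / \<sigma>)\<close>, the closed
  form of the incomplete Gamma function turns the Gamma term of \<open>lower_prim\<close>, which carries \<open>N\<close>,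
  into \<open>P\<close> times a polynomial of degree \<open>k\<close>, and the one of \<open>upper_prim\<close>, which carries \<open>P\<close>, into
  \<open>N\<close> times a polynomial. The power terms supply exactly the missing terms \<open>j = k + 1\<close> of these
  polynomials.
\<close>
lemma prim_difference:
  assumes "\<sigma> > 0" "n > 0" and v: "v = t + (real n - 1) * \<mu>"
  shows "exp (- t / \<sigma>) * lower_prim \<mu> \<sigma> n a b e t - exp (t / \<sigma>) * upper_prim \<mu> \<sigma> n a b e t
    = (\<Sum>j\<le>n. alpha_shift \<sigma> n a j * v ^ j) * exp (t / \<sigma>)
      + (\<Sum>j\<le>n. beta_shift \<sigma> n b j * v ^ j) * exp (- t / \<sigma>)
      + 2 * (2 * \<sigma>) ^ n * e"
proof -
  define P where "P = exp (t / \<sigma>)"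
  define N where "N = exp (- t / \<sigma>)"
  have PN: "N * P = 1" by (simp add: P_def N_def exp_add[symmetric])
  define S where "S s k = (\<Sum>j\<le>k. (s / 2) ^ (k + 1 - j) * (fact k / fact j) * v ^ j)" for s :: real and k
  have S_Suc: "(\<Sum>j\<le>k+1. (s / 2) ^ (k + 1 - j) * (fact k / fact j) * v ^ j)
      = S s k + v ^ (k + 1) / real (k + 1)" for s k
  proof -
    have "fact k / fact (Suc k) * v ^ (k + 1) = v ^ (k + 1) / real (k + 1)"
      by (simp add: divide_simps del: of_nat_add of_nat_Suc)
    then show ?thesis unfolding S_def by (simp add: atMost_Suc)
  qed
  have G1: "N * (exp (- 2 * (real n - 1) * \<mu> / \<sigma>) * \<sigma> ^ (k + 1) * (-1) ^ k / 2 ^ (k + 1)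
       * inc_Gamma (1 + k) (- 2 * v / \<sigma>)) = - (P * S (- \<sigma>) k)" for k
  proof -
    have r: "- 2 * v / \<sigma> = - 2 / \<sigma> * v" by simp
    have 1: "inc_Gamma (1 + k) (- 2 * v / \<sigma>) / (- 2 / \<sigma>) ^ (k + 1) = exp (- (- 2 / \<sigma> * v)) * S (- \<sigma>) k"
      using inc_Gamma_expand[of "- 2 / \<sigma>" k v] assms(1) unfolding r by (simp add: S_def)
    have 2: "N * exp (- 2 * (real n - 1) * \<mu> / \<sigma>) * exp (- (- 2 / \<sigma> * v)) = P"
      using assms(1) by (simp add: N_def P_def v exp_add[symmetric] field_simps)
    have 3: "\<sigma> ^ (k + 1) * (-1) ^ k / 2 ^ (k + 1) = - 1 / (- 2 / \<sigma>) ^ (k + 1)"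
    proof -
      have "(- 2 / \<sigma>) ^ (k + 1) = (-1) ^ (k + 1) * (2 / \<sigma>) ^ (k + 1)"
        by (subst power_mult_distrib[symmetric]) simp
      then show ?thesis using assms(1) by (cases "even k") (simp_all add: power_divide)
    qed
    have "N * (X * Y * Z / W * G) = - (P * T)"
      if "G / R = E * T" "N * X * E = P" "Y * Z / W = - 1 / R" for X Y Z W G R E T :: real
    proof -
      have "N * (X * Y * Z / W * G) = N * X * (Y * Z / W) * G" by simp
      also have "\<dots> = - (N * X * (G / R))" unfolding that(3) by simp
      also have "\<dots> = - (N * X * E * T)" unfolding that(1) by simp
      finally show ?thesis unfolding that(2) .
    qed
    from this[OF 1 2 3] show ?thesis .
  qed
  have G2: "P * (exp (2 * (real n - 1) * \<mu> / \<sigma>) * \<sigma> ^ (k + 1) / 2 ^ (k + 1)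
       * inc_Gamma (1 + k) (2 * v / \<sigma>)) = N * S \<sigma> k" for k
  proof -
    have r: "2 * v / \<sigma> = 2 / \<sigma> * v" by simp
    have 1: "inc_Gamma (1 + k) (2 * v / \<sigma>) / (2 / \<sigma>) ^ (k + 1) = exp (- (2 / \<sigma> * v)) * S \<sigma> k"
      using inc_Gamma_expand[of "2 / \<sigma>" k v] assms(1) unfolding r by (simp add: S_def)
    have 2: "P * exp (2 * (real n - 1) * \<mu> / \<sigma>) * exp (- (2 / \<sigma> * v)) = N"
      using assms(1) by (simp add: N_def P_def v exp_add[symmetric] field_simps)
    have 3: "\<sigma> ^ (k + 1) / 2 ^ (k + 1) = 1 / (2 / \<sigma>) ^ (k + 1)"
      by (simp add: power_divide)
    have "P * (X * Y / W * G) = N * T"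
      if "G / R = E * T" "P * X * E = N" "Y / W = 1 / R" for X Y W G R E T :: real
    proof -
      have "P * (X * Y / W * G) = P * X * (Y / W) * G" by simp
      also have "\<dots> = P * X * (G / R)" unfolding that(3) by simp
      also have "\<dots> = P * X * E * T" unfolding that(1) by simp
      finally show ?thesis unfolding that(2) .
    qed
    from this[OF 1 2 3] show ?thesis .
  qed
  let ?V = "\<lambda>k. v ^ (k + 1) / real (k + 1)"
  have "N * lower_prim \<mu> \<sigma> n a b e t
      = (\<Sum>k<n. a k * - (P * S (- \<sigma>) k) + b k * (N * ?V k)) + e * (2 * \<sigma>) ^ n"
    unfolding lower_prim_def v[symmetric] distrib_left sum_distrib_left G1[symmetric]
      P_def[symmetric]
    using PN by (simp add: mult_ac)
  moreover have "P * upper_prim \<mu> \<sigma> n a b e t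
      = (\<Sum>k<n. a k * (P * ?V k) - b k * (N * S \<sigma> k)) - e * (2 * \<sigma>) ^ n"
    unfolding upper_prim_def v[symmetric] right_diff_distrib sum_distrib_left G2[symmetric]
      N_def[symmetric]
    using PN by (simp add: mult_ac)
  moreover have "(\<Sum>k<n. a k * - (P * S (- \<sigma>) k) + b k * (N * ?V k))
      - (\<Sum>k<n. a k * (P * ?V k) - b k * (N * S \<sigma> k))
      = (\<Sum>k<n. - (a k * (S (- \<sigma>) k + ?V k)) * P + b k * (S \<sigma> k + ?V k) * N)"
  proof -
    have alg: "A * - (P * X) + B * (N * V) - (A * (P * V) - B * (N * Y)) = - (A * (X + V)) * P + B * (Y + V) * N"
      for A B V X Y :: real
      by (simp add: algebra_simps)
    show ?thesis unfolding sum_subtractf[symmetric] alg ..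
  qed
  moreover have "\<dots> = (\<Sum>j\<le>n. alpha_shift \<sigma> n a j * v ^ j) * P
      + (\<Sum>j\<le>n. beta_shift \<sigma> n b j * v ^ j) * N"
  proof -
    have "(\<Sum>j\<le>n. alpha_shift \<sigma> n a j * v ^ j) = - (\<Sum>j\<le>n. beta_shift (- \<sigma>) n a j * v ^ j)"
      by (simp add: alpha_shift_eq sum_negf)
    then show ?thesis
      unfolding beta_shift_sum[OF assms(2)] S_Suc by (simp add: sum.distrib sum_distrib_right sum_negf sum_subtractf)
  qed
  moreover have "2 * (2 * \<sigma>) ^ n * e = e * (2 * \<sigma>) ^ n + e * (2 * \<sigma>) ^ n" by simp
  ultimately show ?thesis unfolding P_def[symmetric] N_def[symmetric] by linarith
qed

section \<open>The partition of the interval\<close>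
locale lindley_laplace =
  fixes \<mu> \<sigma> h :: real
  assumes sigma_pos: "\<sigma> > 0" and mu_neg: "\<mu> < 0" and h_pos: "h > 0"
begin

text \<open>The number of cells once \<open>n\<close> is large.\<close>
definition cells :: nat where
  "cells = (LEAST r. 0 < r \<and> h < real r * (- \<mu>))"

lemma hn_eq: "hn \<mu> h n = min n cells"
  by (simp add: hn_def cells_def)

lemma cells_pos: "0 < cells" and h_less_cells: "h < real cells * (- \<mu>)"
proof -
  obtain r :: nat where r: "h < real r * (- \<mu>)"
    using reals_Archimedean3[of "- \<mu>"] mu_neg by auto
  then have "0 < r" using h_pos by (cases r) auto
  with r have "0 < cells \<and> h < real cells * (- \<mu>)"
    unfolding cells_def by (intro LeastI[of "\<lambda>r. 0 < r \<and> h < real r * (- \<mu>)" r]) simp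
  then show "0 < cells" "h < real cells * (- \<mu>)" by auto
qed

lemma less_cells: "r < cells \<Longrightarrow> real r * (- \<mu>) \<le> h"
  using not_less_Least[of r "\<lambda>r. 0 < r \<and> h < real r * (- \<mu>)"] h_pos
  unfolding cells_def[symmetric] by (cases "r = 0") auto

lemma hn_pos: "n > 0 \<Longrightarrow> hn \<mu> h n > 0"
  using cells_pos by (simp add: hn_eq)

lemma left_end_1 [simp]: "left_end \<mu> (Suc 0) = 0"
  by (simp add: left_end_def)

lemma left_end_Suc: "left_end \<mu> (Suc i) = - real i * \<mu>"
  by (simp add: left_end_def)

lemma left_end_mono: "i \<le> j \<Longrightarrow> left_end \<mu> i \<le> left_end \<mu> j"
  using mu_neg by (auto simp: left_end_def mult_right_mono_neg)

lemma left_end_le_h: "i \<le> hn \<mu> h n \<Longrightarrow> left_end \<mu> i \<le> h"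
  using less_cells[of "i - 1"] cells_pos h_pos mu_neg
  by (cases i) (auto simp: hn_eq left_end_def)

lemma right_end_last: "right_end \<mu> h n (hn \<mu> h n) = h"
  by (simp add: right_end_def)

lemma right_end_eq_left_end: "i < hn \<mu> h n \<Longrightarrow> right_end \<mu> h n i = left_end \<mu> (Suc i)"
  by (simp add: right_end_def left_end_Suc)

lemma left_end_le_right_end: "i \<le> hn \<mu> h n \<Longrightarrow> left_end \<mu> i \<le> right_end \<mu> h n i"
  using left_end_mono[of i "Suc i"] left_end_le_h[of i n]
  by (cases "i < hn \<mu> h n") (auto simp: right_end_def left_end_Suc)

lemma right_end_le_left_end:
  "i < j \<Longrightarrow> j \<le> hn \<mu> h n \<Longrightarrow> right_end \<mu> h n i \<le> left_end \<mu> j"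
  using left_end_mono[of "Suc i" j] by (simp add: right_end_eq_left_end)

lemma right_end_le_h: "i \<le> hn \<mu> h n \<Longrightarrow> right_end \<mu> h n i \<le> h"
  using left_end_le_h[of "Suc i" n]
  by (cases "i < hn \<mu> h n") (auto simp: right_end_def left_end_Suc)

lemma part_disjoint:
  assumes "i \<le> hn \<mu> h n" "j \<le> hn \<mu> h n" "y \<in> part \<mu> h n i" "y \<in> part \<mu> h n j"
  shows "i = j"
  using right_end_le_left_end[of i j n] right_end_le_left_end[of j i n] assms
  by (cases i j rule: linorder_cases) (auto simp: part_def)

lemma part_exists:
  assumes "n > 0" "0 \<le> y" "y < h"
  obtains i where "1 \<le> i" "i \<le> hn \<mu> h n" "y \<in> part \<mu> h n i"
proof -
  have "\<exists>i. 1 \<le> i \<and> i \<le> Suc m \<and> y \<in> part \<mu> h n i"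
    if "Suc m \<le> hn \<mu> h n" "y < right_end \<mu> h n (Suc m)" for m
    using that
  proof (induction m)
    case 0
    then show ?case using assms by (auto simp: part_def)
  next
    case (Suc m)
    show ?case
    proof (cases "y < left_end \<mu> (Suc (Suc m))")
      case True
      then show ?thesis using Suc by (auto simp: right_end_eq_left_end intro: le_SucI)
    next
      case False
      then show ?thesis using Suc.prems by (auto simp: part_def)
    qed
  qed
  from this[of "hn \<mu> h n - 1"] show ?thesis
    using hn_pos[OF assms(1)] assms that by (auto simp: right_end_last)
qed

text \<open>
  The last cell needs care, since its right end is \<open>h\<close> at either time. If \<open>n < cells\<close>, a new cell
  is added at time \<open>n + 1\<close>, and the shifted last cell lies in the old last cell as \<open>h + \<mu> < h\<close>.
  Otherwise the number of cells is \<open>cells\<close> at both times, and the shift of \<open>h\<close> stays below the right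
  end of the cell before the last by the choice of \<open>cells\<close>.
\<close>
lemma part_shift:
  assumes n: "n > 0" and i: "1 < i" "i \<le> hn \<mu> h (Suc n)" and y: "y \<in> part \<mu> h (Suc n) i"
  shows "i - 1 \<in> {1..hn \<mu> h n}" and "y + \<mu> \<in> part \<mu> h n (i - 1)" and "y + \<mu> < h"
proof -
  show s: "i - 1 \<in> {1..hn \<mu> h n}" using i by (auto simp: hn_eq)
  have yh: "y < h" using right_end_le_h[OF i(2)] y by (auto simp: part_def)
  then show "y + \<mu> < h" using mu_neg by simp
  have "left_end \<mu> (i - 1) \<le> y + \<mu>"
    using y i by (simp add: part_def left_end_def of_nat_diff algebra_simps)
  moreover have "y + \<mu> < right_end \<mu> h n (i - 1)"
  proof (cases "i - 1 < hn \<mu> h n")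
    case True
    have "y < - real i * \<mu>"
    proof (cases "i < hn \<mu> h (Suc n)")
      case True
      then show ?thesis using y by (simp add: part_def right_end_def)
    next
      case False
      then have "i = cells" using True i by (auto simp: hn_eq min_def split: if_splits)
      then show ?thesis using yh h_less_cells by simp
    qed
    with True i show ?thesis by (simp add: right_end_def of_nat_diff algebra_simps)
  next
    case False
    with s have "i - 1 = hn \<mu> h n" by auto
    then show ?thesis using yh mu_neg by (simp add: right_end_last)
  qed
  ultimately show "y + \<mu> \<in> part \<mu> h n (i - 1)" by (simp add: part_def)
qed

text \<open>The point \<open>y\<close> only witnesses that the cell is not empty, which makes \<open>i\<^sup>*\<close> well defined.\<close>
lemma istar_eq:
  assumes "n > 0" "1 < i" "i \<le> hn \<mu> h (Suc n)" "y \<in> part \<mu> h (Suc n) i"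
  shows "istar \<mu> h n i = i - 1"
  unfolding istar_def
proof (rule the_equality, intro conjI ballI)
  show "i - 1 \<in> {1..hn \<mu> h n}" by (rule part_shift(1)[OF assms])
  show "min (x + \<mu>) h \<in> part \<mu> h n (i - 1)" if "x \<in> part \<mu> h (Suc n) i" for x
    using part_shift(2,3)[OF assms(1-3) that] by (simp add: min_def)
next
  fix k assume k: "k \<in> {1..hn \<mu> h n} \<and> (\<forall>x\<in>part \<mu> h (Suc n) i. min (x + \<mu>) h \<in> part \<mu> h n k)"
  have "y + \<mu> \<in> part \<mu> h n k"
    using k assms(4) part_shift(3)[OF assms] by (auto simp: min_def split: if_splits)
  then show "k = i - 1"
    using k part_shift(1,2)[OF assms] by (intro part_disjoint) auto
qed

section \<open>The recursion for the coefficients\<close>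
definition exit_prob :: "nat \<Rightarrow> real \<Rightarrow> real" where
  "exit_prob n y = (\<Sum>i=1..hn \<mu> h n. P_piece \<mu> \<sigma> h n i y)"

abbreviation piece :: "nat \<Rightarrow> nat \<Rightarrow> real \<Rightarrow> real" where
  "piece n i \<equiv> quasi_poly \<mu> \<sigma> n (alpha \<mu> \<sigma> h n i) (beta \<mu> \<sigma> h n i) (eta \<mu> \<sigma> h n i)"

abbreviation upper :: "nat \<Rightarrow> nat \<Rightarrow> real \<Rightarrow> real" where
  "upper n i \<equiv> upper_prim \<mu> \<sigma> n (alpha \<mu> \<sigma> h n i) (beta \<mu> \<sigma> h n i) (eta \<mu> \<sigma> h n i)"

abbreviation lower :: "nat \<Rightarrow> nat \<Rightarrow> real \<Rightarrow> real" where
  "lower n i \<equiv> lower_prim \<mu> \<sigma> n (alpha \<mu> \<sigma> h n i) (beta \<mu> \<sigma> h n i) (eta \<mu> \<sigma> h n i)"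

abbreviation Kn :: "nat \<Rightarrow> nat \<Rightarrow> nat \<Rightarrow> real" where
  "Kn n s \<equiv> K \<mu> \<sigma> h n s (alpha \<mu> \<sigma> h n) (beta \<mu> \<sigma> h n) (eta \<mu> \<sigma> h n)"

lemma exit_prob_eq_piece:
  assumes i: "1 \<le> i" "i \<le> hn \<mu> h n" "y \<in> part \<mu> h n i"
  shows "exit_prob n y = piece n i y"
proof -
  have "exit_prob n y = (\<Sum>j\<in>{i}. P_piece \<mu> \<sigma> h n j y)"
    unfolding exit_prob_def
    by (rule sum.mono_neutral_right)
       (use i part_disjoint in \<open>auto simp: P_piece_def indicator_def\<close>)
  then show ?thesis using i by (simp add: P_piece_def quasi_poly_def)
qed

lemma K_upper: "s < l \<Longrightarrow> Kn n s l = upper n l (right_end \<mu> h n l) - upper n l (left_end \<mu> l)"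
  unfolding K_def over_def upper_prim_def
  by (simp add: sum_subtractf[symmetric] right_diff_distrib sum.distrib[symmetric])
     (simp add: algebra_simps sum_subtractf sum.distrib)

lemma K_lower: "0 < l \<Longrightarrow> l < s \<Longrightarrow> Kn n s l = lower n l (right_end \<mu> h n l) - lower n l (left_end \<mu> l)"
  unfolding K_def over_def lower_prim_def
  by (simp add: sum_subtractf[symmetric] right_diff_distrib sum.distrib[symmetric])
     (simp add: algebra_simps sum_subtractf sum.distrib)

text \<open>
  The point \<open>0\<close> always lies in the first cell. The common factor \<open>2\<^sup>n\<^sup>+\<^sup>1 \<sigma>\<^sup>n\<close> of the coefficients
  at time \<open>n + 1\<close>, times the \<open>1/2\<close> in \<open>F(-x)\<close>, gives the factor here.
\<close>
lemma K_zero: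
  assumes "n > 0"
  shows "Kn n s 0 = 2 ^ n * \<sigma> ^ n * exit_prob n 0"
proof -
  have z: "0 \<in> part \<mu> h n 1"
    using h_pos mu_neg by (auto simp: part_def right_end_def)
  have "exit_prob n 0 = piece n 1 0"
    using z hn_pos[OF assms] by (intro exit_prob_eq_piece) auto
  moreover have "2 ^ n * \<sigma> ^ n * X = \<sigma> * (2 ^ n * \<sigma> ^ (n - 1) * X)" for X
    using assms by (cases n) auto
  ultimately show ?thesis
    using sigma_pos assms quasi_poly_scaled[OF sigma_pos, of n \<mu> "alpha \<mu> \<sigma> h n 1" "beta \<mu> \<sigma> h n 1" "eta \<mu> \<sigma> h n 1" 0]
    by (cases n) (simp_all add: K_def distrib_left sum_distrib_left power_mult_distrib mult_ac)
qed

end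

context lindley_laplace
begin

lemma alpha_1:
  assumes "n > 0"
  shows "alpha \<mu> \<sigma> h (Suc n) 1 j =
    (if j = 0 then exp (\<mu> / \<sigma>) * ((\<Sum>l=1..hn \<mu> h n. Kn n 0 l) - Kn n 0 0) else 0)"
  using assms by simp

text \<open>
  The recursions are now regrouped into a contribution of the whole cells and of the end of the cut
  cell, which is a constant, and the contribution of the cutting point.
\<close>
lemma alpha_gt_1:
  assumes "n > 0" "i \<noteq> 1" and s: "s = istar \<mu> h n i"
  shows "alpha \<mu> \<sigma> h (Suc n) i j =
    exp (\<mu> / \<sigma>) *
      ((if j = 0 then (\<Sum>l=s+1..hn \<mu> h n. Kn n s l) + upper n s (right_end \<mu> h n s) else 0)
       + alpha_shift \<sigma> n (alpha \<mu> \<sigma> h n s) j)"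
proof (cases "j = 0")
  case True
  have e: "fact k * \<sigma> ^ (k + 1) * (-1) ^ k / 2 ^ (k + 1) = - ((- \<sigma> / 2) ^ (k + 1) * fact k)" for k
  proof -
    have "(- \<sigma> / 2) ^ (k + 1) = (-1) ^ (k + 1) * (\<sigma> / 2) ^ (k + 1)"
      by (subst power_mult_distrib[symmetric]) simp
    then show ?thesis by (simp add: power_divide mult_ac)
  qed
  have set: "{0..n - 1} = {..<n}" using assms by auto
  let ?u = "right_end \<mu> h n s + (real n - 1) * \<mu>"
  have "(\<Sum>k<n. alpha \<mu> \<sigma> h n s k * (?u ^ (k + 1) / real (k + 1) + fact k * \<sigma> ^ (k + 1) * (-1) ^ k / 2 ^ (k + 1))
          - beta \<mu> \<sigma> h n s k * (exp (2 * (real n - 1) * \<mu> / \<sigma>) * \<sigma> ^ (k + 1) / 2 ^ (k + 1))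
             * inc_Gamma (1 + k) (2 * ?u / \<sigma>))
         - eta \<mu> \<sigma> h n s * (2 * \<sigma>) ^ n * exp (- right_end \<mu> h n s / \<sigma>)
      = upper n s (right_end \<mu> h n s) + alpha_shift \<sigma> n (alpha \<mu> \<sigma> h n s) 0"
    unfolding e upper_prim_def alpha_shift_def diff_0_eq_0 set
    by (simp add: distrib_left sum.distrib sum_subtractf sum_negf mult.assoc)
  then show ?thesis
    using True assms by (simp add: Let_def)
next
  case False
  then show ?thesis
    using assms by (simp add: Let_def alpha_shift_def)
qed

lemma beta_gt_1:
  assumes "n > 0" "i \<noteq> 1" and s: "s = istar \<mu> h n i"
  shows "beta \<mu> \<sigma> h (Suc n) i j =
    exp (- \<mu> / \<sigma>) *
      ((if j = 0 then (\<Sum>l<s. Kn n s l) - lower n s (left_end \<mu> s) else 0)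
       + beta_shift \<sigma> n (beta \<mu> \<sigma> h n s) j)"
proof (cases "j = 0")
  case True
  have e: "fact k * \<sigma> ^ (k + 1) / 2 ^ (k + 1) = (\<sigma> / 2) ^ (k + 1) * fact k" for k
    by (simp add: power_divide)
  have set: "{0..n - 1} = {..<n}" using assms by auto
  have u: "(- real s + 1 + real n - 1) * \<mu> = left_end \<mu> s + (real n - 1) * \<mu>"
    by (simp add: left_end_def algebra_simps)
  have l: "- (real s - 1) * \<mu> = left_end \<mu> s"
    by (simp add: left_end_def)
  let ?u = "left_end \<mu> s + (real n - 1) * \<mu>"
  have "(\<Sum>k<n. - alpha \<mu> \<sigma> h n s k * (exp (- 2 * (real n - 1) * \<mu> / \<sigma>) * \<sigma> ^ (k + 1) * (-1) ^ k / 2 ^ (k + 1))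
            * inc_Gamma (1 + k) (- 2 * ((- real s + 1 + real n - 1) * \<mu>) / \<sigma>)
          + beta \<mu> \<sigma> h n s k * (- (((- real s + 1 + real n - 1) * \<mu>) ^ (k + 1) / real (k + 1))
             + fact k * \<sigma> ^ (k + 1) / 2 ^ (k + 1)))
         - eta \<mu> \<sigma> h n s * (2 * \<sigma>) ^ n * exp (- (real s - 1) * \<mu> / \<sigma>)
      = - lower n s (left_end \<mu> s) + beta_shift \<sigma> n (beta \<mu> \<sigma> h n s) 0"
    unfolding e u l lower_prim_def beta_shift_def diff_0_eq_0 set
    by (simp add: distrib_left right_diff_distrib sum.distrib sum_subtractf sum_negf mult.assoc)
  then show ?thesis
    using True assms by (simp add: Let_def)
next
  case False
  then show ?thesis
    using assms by (simp add: Let_def beta_shift_def)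
qed

lemma quasi_poly_split_0:
  "(\<Sum>j<Suc n. (E * ((if j = 0 then c else 0) + f j)) * v ^ j * x) = E * x * c + E * x * (\<Sum>j\<le>n. f j * v ^ j)"
  for E c v x :: real and f :: "nat \<Rightarrow> real"
proof -
  have "(E * ((if j = 0 then c else 0) + f j)) * v ^ j * x = (if j = 0 then E * x * c else 0) + E * x * (f j * v ^ j)" for j
    by (auto simp: algebra_simps)
  then show ?thesis
    by (simp only: sum.distrib sum_distrib_left lessThan_Suc_atMost) (simp add: sum.delta)
qed

text \<open>
  The right-hand side is what the integration over the cells will produce: whole cells to the left
  of \<open>t\<close> and the left part of the cut cell \<open>s\<close> with weight \<open>exp (- t / \<sigma>)\<close>, the rest with weight
  \<open>exp (t / \<sigma>)\<close>. The index \<open>0\<close> in the first sum is the atom at \<open>0\<close>.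
\<close>
lemma piece_Suc_gt_1:
  assumes "n > 0" "i \<noteq> 1" and s: "s = istar \<mu> h n i" and t: "t = x + \<mu>"
  shows "2 ^ Suc n * \<sigma> ^ n * piece (Suc n) i x =
     exp (- t / \<sigma>) * ((\<Sum>l<s. Kn n s l) + (lower n s t - lower n s (left_end \<mu> s)))
   + exp (t / \<sigma>) * ((\<Sum>l=s+1..hn \<mu> h n. Kn n s l) + (upper n s (right_end \<mu> h n s) - upper n s t))"
proof -
  define v where "v = x + (real (Suc n) - 1) * \<mu>"
  have v: "v = t + (real n - 1) * \<mu>" by (simp add: v_def t algebra_simps)
  let ?A = "(\<Sum>l=s+1..hn \<mu> h n. Kn n s l) + upper n s (right_end \<mu> h n s)"
  let ?B = "(\<Sum>l<s. Kn n s l) - lower n s (left_end \<mu> s)"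
  have E: "exp (\<mu> / \<sigma>) * exp (x / \<sigma>) = exp (t / \<sigma>)" "exp (- \<mu> / \<sigma>) * exp (- x / \<sigma>) = exp (- t / \<sigma>)"
    by (simp_all add: t exp_add[symmetric] add_divide_distrib diff_divide_distrib add.commute)
  have eta: "eta \<mu> \<sigma> h (Suc n) i = eta \<mu> \<sigma> h n s"
    using assms by simp
  have "2 ^ Suc n * \<sigma> ^ n * piece (Suc n) i x
     = (\<Sum>j<Suc n. alpha \<mu> \<sigma> h (Suc n) i j * v ^ j * exp (x / \<sigma>) + beta \<mu> \<sigma> h (Suc n) i j * v ^ j * exp (- x / \<sigma>))
       + 2 ^ Suc n * \<sigma> ^ n * eta \<mu> \<sigma> h n s"
    using quasi_poly_scaled[OF sigma_pos, of "Suc n"] unfolding eta[symmetric] v_def diff_Suc_1 by blast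
  also have "\<dots> = exp (t / \<sigma>) * ?A + exp (t / \<sigma>) * (\<Sum>j\<le>n. alpha_shift \<sigma> n (alpha \<mu> \<sigma> h n s) j * v ^ j)
      + (exp (- t / \<sigma>) * ?B + exp (- t / \<sigma>) * (\<Sum>j\<le>n. beta_shift \<sigma> n (beta \<mu> \<sigma> h n s) j * v ^ j))
      + 2 * (2 * \<sigma>) ^ n * eta \<mu> \<sigma> h n s"
    unfolding sum.distrib alpha_gt_1[OF assms(1-3)] beta_gt_1[OF assms(1-3)] quasi_poly_split_0 E
    by (simp add: power_mult_distrib)
  also have "\<dots> = exp (t / \<sigma>) * ?A + exp (- t / \<sigma>) * ?B +
     (exp (- t / \<sigma>) * lower n s t - exp (t / \<sigma>) * upper n s t)"
    unfolding prim_difference[OF sigma_pos assms(1) v] by (simp only: ac_simps)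
  also have "\<dots> = exp (- t / \<sigma>) * ((\<Sum>l<s. Kn n s l) + (lower n s t - lower n s (left_end \<mu> s)))
   + exp (t / \<sigma>) * ((\<Sum>l=s+1..hn \<mu> h n. Kn n s l) + (upper n s (right_end \<mu> h n s) - upper n s t))"
    by (simp only: right_diff_distrib distrib_left)
  finally show ?thesis .
qed

lemma piece_Suc_1:
  assumes "n > 0" and t: "t = x + \<mu>"
  shows "2 ^ Suc n * \<sigma> ^ n * piece (Suc n) 1 x =
     exp (t / \<sigma>) * ((\<Sum>l=1..hn \<mu> h n. Kn n 0 l) - Kn n 0 0) + 2 * Kn n 0 0"
proof -
  define v where "v = x + (real (Suc n) - 1) * \<mu>"
  let ?A = "(\<Sum>l=1..hn \<mu> h n. Kn n 0 l) - Kn n 0 0"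
  have E: "exp (\<mu> / \<sigma>) * exp (x / \<sigma>) = exp (t / \<sigma>)"
    by (simp_all add: t exp_add[symmetric] add_divide_distrib add.commute)
  have al: "alpha \<mu> \<sigma> h (Suc n) 1 j = exp (\<mu> / \<sigma>) * ((if j = 0 then ?A else 0) + 0)" for j
    unfolding alpha_1[OF assms(1)] by simp
  have be: "beta \<mu> \<sigma> h (Suc n) 1 j = 0" for j
    using assms by simp
  have eta: "2 ^ Suc n * \<sigma> ^ n * eta \<mu> \<sigma> h (Suc n) 1 = 2 * Kn n 0 0"
    using assms sigma_pos by simp
  have "2 ^ Suc n * \<sigma> ^ n * piece (Suc n) 1 x
     = (\<Sum>j<Suc n. alpha \<mu> \<sigma> h (Suc n) 1 j * v ^ j * exp (x / \<sigma>) + beta \<mu> \<sigma> h (Suc n) 1 j * v ^ j * exp (- x / \<sigma>))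
       + 2 ^ Suc n * \<sigma> ^ n * eta \<mu> \<sigma> h (Suc n) 1"
    using quasi_poly_scaled[OF sigma_pos, of "Suc n"] unfolding v_def diff_Suc_1 by blast
  also have "\<dots> = exp (t / \<sigma>) * ?A + 2 * Kn n 0 0"
    unfolding sum.distrib al be quasi_poly_split_0 E eta by simp
  finally show ?thesis .
qed

end

context lindley_laplace
begin

section \<open>Integration against the Laplace density\<close>
lemma laplace_density_eq: "laplace_density \<mu> \<sigma> (y - x) = 1 / (2 * \<sigma>) * exp (- \<bar>y - (x + \<mu>)\<bar> / \<sigma>)"
  by (simp add: laplace_density_def algebra_simps)

text \<open>
  The cells are half-open, so the formula for \<open>f\<close> may fail at \<open>b\<close>, and a single point does not
  change the integral.
\<close>
lemma has_integral_above:
  assumes "n > 0" "a \<le> b" and t: "t = x + \<mu>" "t \<le> a"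
    and f: "\<And>y. y \<in> {a..<b} \<Longrightarrow> f y = quasi_poly \<mu> \<sigma> n \<alpha> \<beta> \<eta> y"
  shows "((\<lambda>y. laplace_density \<mu> \<sigma> (y - x) * f y) has_integral
     exp (t / \<sigma>) * (upper_prim \<mu> \<sigma> n \<alpha> \<beta> \<eta> b - upper_prim \<mu> \<sigma> n \<alpha> \<beta> \<eta> a) / (2 ^ Suc n * \<sigma> ^ n)) {a..b}"
proof -
  define C where "C = exp (t / \<sigma>) / (2 ^ Suc n * \<sigma> ^ n)"
  have "((\<lambda>y. C * upper_prim \<mu> \<sigma> n \<alpha> \<beta> \<eta> y) has_real_derivative
      1 / (2 * \<sigma>) * exp (- (y - t) / \<sigma>) * quasi_poly \<mu> \<sigma> n \<alpha> \<beta> \<eta> y) (at y)" for y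
  proof -
    have "C * (2 ^ n * \<sigma> ^ (n - 1) * exp (- y / \<sigma>)) = 1 / (2 * \<sigma>) * (exp (t / \<sigma>) * exp (- y / \<sigma>))"
      using assms(1) sigma_pos by (cases n) (simp_all add: C_def)
    also have "exp (t / \<sigma>) * exp (- y / \<sigma>) = exp (- (y - t) / \<sigma>)"
      by (simp add: exp_add[symmetric] diff_divide_distrib)
    finally show ?thesis
      using DERIV_cmult[OF upper_prim_deriv[OF sigma_pos assms(1), of \<mu> \<alpha> \<beta> \<eta> y], of C]
      by (simp only: mult.assoc[symmetric])
  qed
  then have "((\<lambda>y. 1 / (2 * \<sigma>) * exp (- (y - t) / \<sigma>) * quasi_poly \<mu> \<sigma> n \<alpha> \<beta> \<eta> y) has_integral
      C * upper_prim \<mu> \<sigma> n \<alpha> \<beta> \<eta> b - C * upper_prim \<mu> \<sigma> n \<alpha> \<beta> \<eta> a) {a..b}"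
    using assms(2) by (intro fundamental_theorem_of_calculus)
      (auto simp: has_real_derivative_iff_has_vector_derivative[symmetric] intro: DERIV_subset)
  then have "((\<lambda>y. laplace_density \<mu> \<sigma> (y - x) * f y) has_integral
      C * upper_prim \<mu> \<sigma> n \<alpha> \<beta> \<eta> b - C * upper_prim \<mu> \<sigma> n \<alpha> \<beta> \<eta> a) {a..b}"
    by (rule has_integral_spike_finite[where S="{b}", rotated 2])
       (use t in \<open>auto simp: laplace_density_eq f\<close>)
  then show ?thesis by (simp add: C_def right_diff_distrib diff_divide_distrib)
qed

lemma has_integral_below:
  assumes "n > 0" "a \<le> b" and t: "t = x + \<mu>" "b \<le> t"
    and f: "\<And>y. y \<in> {a..<b} \<Longrightarrow> f y = quasi_poly \<mu> \<sigma> n \<alpha> \<beta> \<eta> y"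
  shows "((\<lambda>y. laplace_density \<mu> \<sigma> (y - x) * f y) has_integral
     exp (- t / \<sigma>) * (lower_prim \<mu> \<sigma> n \<alpha> \<beta> \<eta> b - lower_prim \<mu> \<sigma> n \<alpha> \<beta> \<eta> a) / (2 ^ Suc n * \<sigma> ^ n)) {a..b}"
proof -
  define C where "C = exp (- t / \<sigma>) / (2 ^ Suc n * \<sigma> ^ n)"
  have "((\<lambda>y. C * lower_prim \<mu> \<sigma> n \<alpha> \<beta> \<eta> y) has_real_derivative
      1 / (2 * \<sigma>) * exp ((y - t) / \<sigma>) * quasi_poly \<mu> \<sigma> n \<alpha> \<beta> \<eta> y) (at y)" for y
  proof -
    have "C * (2 ^ n * \<sigma> ^ (n - 1) * exp (y / \<sigma>)) = 1 / (2 * \<sigma>) * (exp (- t / \<sigma>) * exp (y / \<sigma>))"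
      using assms(1) sigma_pos by (cases n) (simp_all add: C_def)
    also have "exp (- t / \<sigma>) * exp (y / \<sigma>) = exp ((y - t) / \<sigma>)"
      by (simp add: exp_add[symmetric] diff_divide_distrib)
    finally show ?thesis
      using DERIV_cmult[OF lower_prim_deriv[OF sigma_pos assms(1), of \<mu> \<alpha> \<beta> \<eta> y], of C]
      by (simp only: mult.assoc[symmetric])
  qed
  then have "((\<lambda>y. 1 / (2 * \<sigma>) * exp ((y - t) / \<sigma>) * quasi_poly \<mu> \<sigma> n \<alpha> \<beta> \<eta> y) has_integral
      C * lower_prim \<mu> \<sigma> n \<alpha> \<beta> \<eta> b - C * lower_prim \<mu> \<sigma> n \<alpha> \<beta> \<eta> a) {a..b}"
    using assms(2) by (intro fundamental_theorem_of_calculus)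
      (auto simp: has_real_derivative_iff_has_vector_derivative[symmetric] intro: DERIV_subset)
  then have "((\<lambda>y. laplace_density \<mu> \<sigma> (y - x) * f y) has_integral
      C * lower_prim \<mu> \<sigma> n \<alpha> \<beta> \<eta> b - C * lower_prim \<mu> \<sigma> n \<alpha> \<beta> \<eta> a) {a..b}"
    by (rule has_integral_spike_finite[where S="{b}", rotated 2])
       (use t in \<open>auto simp: laplace_density_eq f\<close>)
  then show ?thesis by (simp add: C_def right_diff_distrib diff_divide_distrib)
qed

lemma has_integral_partition:
  fixes f :: "real \<Rightarrow> real"
  assumes n: "n > 0"
    and f: "\<And>l. 1 \<le> l \<Longrightarrow> l \<le> hn \<mu> h n \<Longrightarrow> (f has_integral c l) {left_end \<mu> l..right_end \<mu> h n l}"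
  shows "(f has_integral (\<Sum>l=1..hn \<mu> h n. c l)) {0..h}"
proof -
  have "(f has_integral (\<Sum>l=1..Suc m. c l)) {0..right_end \<mu> h n (Suc m)}" if "Suc m \<le> hn \<mu> h n" for m
    using that
  proof (induction m)
    case 0
    then show ?case using f[of 1] by simp
  next
    case (Suc m)
    have e: "right_end \<mu> h n (Suc m) = left_end \<mu> (Suc (Suc m))"
      using Suc.prems by (intro right_end_eq_left_end) simp
    have "(f has_integral (\<Sum>l=1..Suc m. c l) + c (Suc (Suc m))) {0..right_end \<mu> h n (Suc (Suc m))}"
      using Suc.IH Suc.prems f[of "Suc (Suc m)"] left_end_le_right_end[of "Suc (Suc m)" n]
        left_end_mono[of 1 "Suc (Suc m)"]
      by (intro has_integral_combine[where a=0 and c="left_end \<mu> (Suc (Suc m))"]) (simp_all add: e)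
    then show ?case by simp
  qed
  from this[of "hn \<mu> h n - 1"] show ?thesis
    using hn_pos[OF n] by (simp add: right_end_last)
qed

text \<open>
  This is \<open>F(-x)\<close>. For \<open>t < 0\<close> the mode of the density lies inside the domain, which gives the
  second form and eventually the constant term \<open>\<eta>\<close>.
\<close>
lemma laplace_mass_below_0:
  assumes t: "t = x + \<mu>"
  shows "((\<lambda>y. laplace_density \<mu> \<sigma> (y - x)) has_integral
    (if 0 \<le> t then exp (- t / \<sigma>) / 2 else 1 - exp (t / \<sigma>) / 2)) {..0}"
proof -
  have below: "((\<lambda>y. laplace_density \<mu> \<sigma> (y - x)) has_integral exp ((c - t) / \<sigma>) / 2) {..c}" if "c \<le> t" for c
  proof -
    have e: "exp ((y - t) / \<sigma>) = exp (- t / \<sigma>) * exp (1 / \<sigma> * y)" for y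
      by (simp add: exp_add[symmetric] diff_divide_distrib)
    have "((\<lambda>y. exp (- t / \<sigma>) / (2 * \<sigma>) * exp (1 / \<sigma> * y)) has_integral
        exp (- t / \<sigma>) / (2 * \<sigma>) * (exp (1 / \<sigma> * c) / (1 / \<sigma>))) {..c}"
      using sigma_pos by (intro has_integral_mult_right has_integral_exp_Iic) simp
    then have i: "((\<lambda>y. exp (- t / \<sigma>) / (2 * \<sigma>) * exp (1 / \<sigma> * y)) has_integral exp ((c - t) / \<sigma>) / 2) {..c}"
      by (rule has_integral_eq_rhs) (use sigma_pos in \<open>simp add: e\<close>)
    have c: "laplace_density \<mu> \<sigma> (y - x) = exp (- t / \<sigma>) / (2 * \<sigma>) * exp (1 / \<sigma> * y)" if "y \<in> {..c}" for y
    proof -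
      have "- \<bar>y - (x + \<mu>)\<bar> = y - t" using that \<open>c \<le> t\<close> t by simp
      then show ?thesis unfolding laplace_density_eq by (simp add: e)
    qed
    show ?thesis using i by (subst has_integral_cong[OF c]) auto
  qed
  show ?thesis
  proof (cases "0 \<le> t")
    case True
    then show ?thesis using below[of 0] by simp
  next
    case False
    have c: "laplace_density \<mu> \<sigma> (y - x) = 1 / (2 * \<sigma>) * exp (- (y - t) / \<sigma>)" if "y \<in> {t..0}" for y
      using that t by (simp add: laplace_density_eq)
    have "((\<lambda>y. 1 / (2 * \<sigma>) * exp (- (y - t) / \<sigma>)) has_integral
       - exp (- (0 - t) / \<sigma>) / 2 - - exp (- (t - t) / \<sigma>) / 2) {t..0}"
      using False sigma_pos
      by (intro fundamental_theorem_of_calculus)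
         (auto simp: has_real_derivative_iff_has_vector_derivative[symmetric] intro!: derivative_eq_intros)
    then have "((\<lambda>y. laplace_density \<mu> \<sigma> (y - x)) has_integral 1 / 2 - exp (t / \<sigma>) / 2) {t..0}"
      by (subst has_integral_cong[OF c]) auto
    then have "((\<lambda>y. laplace_density \<mu> \<sigma> (y - x)) has_integral exp ((t - t) / \<sigma>) / 2 + (1 / 2 - exp (t / \<sigma>) / 2)) ({..t} \<union> {t..0})"
      using below[of t] False
      by (intro has_integral_Un) (auto intro: negligible_subset[of "{t}"])
    moreover have "{..t} \<union> {t..0} = {..0}" using False by auto
    ultimately show ?thesis using False by simp
  qed
qed

lemma laplace_mass_above_h:
  assumes "x < h"
  shows "((\<lambda>y. laplace_density \<mu> \<sigma> (y - x)) has_integral exp ((x + \<mu> - h) / \<sigma>) / 2) {h..}"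
proof -
  have e: "exp ((x + \<mu> - y) / \<sigma>) = exp ((x + \<mu>) / \<sigma>) * exp (- (1 / \<sigma>) * y)" for y
    by (simp add: exp_add[symmetric] diff_divide_distrib)
  have "((\<lambda>y. exp ((x + \<mu>) / \<sigma>) / (2 * \<sigma>) * exp (- (1 / \<sigma>) * y)) has_integral
      exp ((x + \<mu>) / \<sigma>) / (2 * \<sigma>) * (exp (- (1 / \<sigma>) * h) / (1 / \<sigma>))) {h..}"
    using sigma_pos by (intro has_integral_mult_right has_integral_exp_minus_to_infinity) simp
  then have i: "((\<lambda>y. exp ((x + \<mu>) / \<sigma>) / (2 * \<sigma>) * exp (- (1 / \<sigma>) * y)) has_integral
      exp ((x + \<mu> - h) / \<sigma>) / 2) {h..}"
    by (rule has_integral_eq_rhs) (use sigma_pos in \<open>simp add: e\<close>)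
  have c: "laplace_density \<mu> \<sigma> (y - x) = exp ((x + \<mu>) / \<sigma>) / (2 * \<sigma>) * exp (- (1 / \<sigma>) * y)" if "y \<in> {h..}" for y
  proof -
    have "- \<bar>y - (x + \<mu>)\<bar> = x + \<mu> - y" using that assms mu_neg by simp
    then show ?thesis unfolding laplace_density_eq by (simp add: e)
  qed
  show ?thesis using i by (subst has_integral_cong[OF c]) auto
qed

lemma exit_prob_1:
  assumes "0 \<le> x" "x < h"
  shows "exit_prob 1 x = exp ((x + \<mu> - h) / \<sigma>) / 2"
proof -
  have "hn \<mu> h 1 = 1" using cells_pos by (simp add: hn_eq)
  then have "exit_prob 1 x = piece 1 1 x"
    using assms by (intro exit_prob_eq_piece) (auto simp: part_def right_end_def)
  also have "\<dots> = exp ((\<mu> - h) / \<sigma>) * exp (x / \<sigma>) / 2"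
    by (simp add: quasi_poly_def)
  also have "exp ((\<mu> - h) / \<sigma>) * exp (x / \<sigma>) = exp ((x + \<mu> - h) / \<sigma>)"
    by (simp add: exp_add[symmetric] add_divide_distrib diff_divide_distrib)
  finally show ?thesis .
qed

text \<open>
  The one-step equation for the closed formula. The function \<open>y \<mapsto> exit_prob n (max 0 y)\<close> on
  \<open>(-\<infinity>, h)\<close> merges the two terms of the equation: it is constant on \<open>(-\<infinity>, 0]\<close>, where the
  reflection at \<open>0\<close> acts. Cells are compared with \<open>t\<close>; both sides are multiplied by
  \<open>D = 2\<^sup>n\<^sup>+\<^sup>1 \<sigma>\<^sup>n\<close>.
\<close>
lemma exit_prob_Suc:
  assumes n: "n > 0" and x: "0 \<le> x" "x < h"
  shows "((\<lambda>y. laplace_density \<mu> \<sigma> (y - x) * (if y < h then exit_prob n (max 0 y) else 0))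
    has_integral exit_prob (Suc n) x) UNIV"
proof -
  define t where t: "t = x + \<mu>"
  define D where "D = 2 ^ Suc n * \<sigma> ^ n"
  have D: "D > 0" using sigma_pos by (simp add: D_def)
  let ?f = "\<lambda>y. laplace_density \<mu> \<sigma> (y - x) * exit_prob n y"
  let ?g = "\<lambda>y. laplace_density \<mu> \<sigma> (y - x) * (if y < h then exit_prob n (max 0 y) else 0)"
  let ?m = "hn \<mu> h n"
  define B where "B = (if 0 \<le> t then exp (- t / \<sigma>) / 2 else 1 - exp (t / \<sigma>) / 2)"
  have K0: "2 * Kn n s 0 = D * exit_prob n 0" for s
    using K_zero[OF n, of s] by (simp add: D_def)
  have piece: "exit_prob n y = piece n l y"
    if "1 \<le> l" "l \<le> ?m" "y \<in> {left_end \<mu> l..<right_end \<mu> h n l}" for l y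
    using that by (intro exit_prob_eq_piece) (auto simp: part_def)
  have above: "(?f has_integral exp (t / \<sigma>) * Kn n s l / D) {left_end \<mu> l..right_end \<mu> h n l}"
    if "1 \<le> l" "l \<le> ?m" "s < l" "t \<le> left_end \<mu> l" for s l
    unfolding K_upper[OF that(3)] D_def using that
    by (intro has_integral_above n left_end_le_right_end piece t) auto
  have below: "(?f has_integral exp (- t / \<sigma>) * Kn n s l / D) {left_end \<mu> l..right_end \<mu> h n l}"
    if "1 \<le> l" "l \<le> ?m" "l < s" "right_end \<mu> h n l \<le> t" for s l
  proof -
    have "0 < l" using that by simp
    then show ?thesis
      unfolding K_lower[OF \<open>0 < l\<close> that(3)] D_def using that
      by (intro has_integral_below n left_end_le_right_end piece t) auto
  qed
  \<comment> \<open>\<open>B\<close> is the mass below \<open>0\<close>, so the rest of the proof is an integral over \<open>[0, h]\<close>\<close>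
  have mid: "(?g has_integral exit_prob n 0 * B + I) UNIV" if I: "(?f has_integral I) {0..h}" for I
  proof -
    have "((\<lambda>y. laplace_density \<mu> \<sigma> (y - x) * exit_prob n 0) has_integral B * exit_prob n 0) {..0}"
      unfolding B_def by (intro has_integral_mult_left laplace_mass_below_0 t)
    then have 1: "(?g has_integral B * exit_prob n 0) {..0}"
      using h_pos by (subst has_integral_cong[where g="\<lambda>y. laplace_density \<mu> \<sigma> (y - x) * exit_prob n 0"]) auto
    have 2: "(?g has_integral I) {0..h}"
      by (rule has_integral_spike_finite[where S="{h}", OF _ _ I]) auto
    have 3: "(?g has_integral 0) {h..}"
      by (rule has_integral_is_0) auto
    have "(?g has_integral (B * exit_prob n 0 + I)) ({..0} \<union> {0..h})"
      using h_pos by (intro has_integral_Un 1 2) (auto intro: negligible_subset[of "{0}"])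
    then have "(?g has_integral B * exit_prob n 0 + I + 0) (({..0} \<union> {0..h}) \<union> {h..})"
      by (rule has_integral_Un[OF _ 3]) (use h_pos in \<open>auto intro: negligible_subset[of "{h}"]\<close>)
    moreover have "({..0} \<union> {0..h}) \<union> {h..} = UNIV" by auto
    ultimately show ?thesis by (simp add: mult.commute)
  qed
  obtain i where i: "1 \<le> i" "i \<le> hn \<mu> h (Suc n)" "x \<in> part \<mu> h (Suc n) i"
    using part_exists[of "Suc n" x] x by auto
  have goal: "(?g has_integral exit_prob (Suc n) x) UNIV"
    if "(?f has_integral I) {0..h}" "D * piece (Suc n) i x = D * exit_prob n 0 * B + D * I" for I
  proof -
    have "D * exit_prob (Suc n) x = D * (exit_prob n 0 * B + I)"
      using that(2) exit_prob_eq_piece[OF i] by (simp add: distrib_left)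
    then show ?thesis using mid[OF that(1)] D by simp
  qed
  show ?thesis
  proof (cases "i = 1")
    case True
    have "t < 0"
    proof -
      have "x < - \<mu>"
      proof (cases "1 < hn \<mu> h (Suc n)")
        case True
        then show ?thesis using i \<open>i = 1\<close> by (simp add: part_def right_end_def)
      next
        case False
        then have "cells = 1" using cells_pos n by (auto simp: hn_eq min_def split: if_splits)
        then show ?thesis using h_less_cells x by simp
      qed
      then show ?thesis by (simp add: t)
    qed
    have I: "(?f has_integral (\<Sum>l=1..?m. exp (t / \<sigma>) * Kn n 0 l / D)) {0..h}"
    proof (intro has_integral_partition n above)
      fix l :: nat assume "1 \<le> l"
      then show "t \<le> left_end \<mu> l"
        using \<open>t < 0\<close> left_end_mono[of 1 l] by simp
    qed auto
    show ?thesis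
    proof (rule goal[OF I])
      have "D * piece (Suc n) i x = exp (t / \<sigma>) * ((\<Sum>l=1..?m. Kn n 0 l) - Kn n 0 0) + 2 * Kn n 0 0"
        unfolding True D_def by (rule piece_Suc_1[OF n t])
      also have "\<dots> = 2 * Kn n 0 0 * B + exp (t / \<sigma>) * (\<Sum>l=1..?m. Kn n 0 l)"
        using \<open>t < 0\<close> by (simp add: B_def algebra_simps)
      also have "\<dots> = D * exit_prob n 0 * B + D * (\<Sum>l=1..?m. exp (t / \<sigma>) * Kn n 0 l / D)"
        unfolding K0 using D by (simp add: sum_distrib_left)
      finally show "D * piece (Suc n) i x = D * exit_prob n 0 * B + D * (\<Sum>l=1..?m. exp (t / \<sigma>) * Kn n 0 l / D)" .
    qed
  next
    case False
    then have i1: "1 < i" using i by simp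
    define s where "s = i - 1"
    have s: "s = istar \<mu> h n i" "1 \<le> s" "s \<le> ?m" "t \<in> part \<mu> h n s"
      using istar_eq[OF n i1 i(2,3)] part_shift[OF n i1 i(2,3)] by (auto simp: s_def t)
    have ts: "left_end \<mu> s \<le> t" "t < right_end \<mu> h n s" using s by (auto simp: part_def)
    have t0: "0 \<le> t" using ts left_end_mono[of 1 s] s by simp
    \<comment> \<open>the contribution of the cut cell, and then the contribution of cell \<open>l\<close>, both times \<open>D\<close>\<close>
    define Ks where "Ks = exp (- t / \<sigma>) * (lower n s t - lower n s (left_end \<mu> s))
      + exp (t / \<sigma>) * (upper n s (right_end \<mu> h n s) - upper n s t)"
    define c where "c l = (if l < s then exp (- t / \<sigma>) * Kn n s l
      else if l = s then Ks else exp (t / \<sigma>) * Kn n s l)" for l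
    have I: "(?f has_integral (\<Sum>l=1..?m. c l / D)) {0..h}"
    proof (rule has_integral_partition[OF n])
      fix l assume l: "1 \<le> l" "l \<le> ?m"
      show "(?f has_integral c l / D) {left_end \<mu> l..right_end \<mu> h n l}"
      proof (cases l s rule: linorder_cases)
        case less
        then have "right_end \<mu> h n l \<le> t"
          using right_end_le_left_end[OF less] s ts by force
        then show ?thesis using below[OF l less] less by (simp add: c_def)
      next
        case greater
        then have "t \<le> left_end \<mu> l"
          using right_end_le_left_end[OF greater] l ts by force
        then show ?thesis using above[OF l greater] greater by (simp add: c_def)
      next
        case equal
        have "(?f has_integral exp (- t / \<sigma>) * (lower n s t - lower n s (left_end \<mu> s)) / D
          + exp (t / \<sigma>) * (upper n s (right_end \<mu> h n s) - upper n s t) / D)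
          {left_end \<mu> s..right_end \<mu> h n s}"
          unfolding D_def using ts s
          by (intro has_integral_combine[where c=t] has_integral_below has_integral_above n piece t) auto
        then show ?thesis by (simp add: equal c_def Ks_def add_divide_distrib)
      qed
    qed
    show ?thesis
    proof (rule goal[OF I])
      have split: "{1..?m} = {1..<s} \<union> {s} \<union> {s+1..?m}" using s by auto
      have "(\<Sum>l=1..?m. c l) = (\<Sum>l\<in>{1..<s}. c l) + c s + (\<Sum>l\<in>{s+1..?m}. c l)"
        unfolding split by (subst sum.union_disjoint; auto)+
      also have "\<dots> = exp (- t / \<sigma>) * (\<Sum>l\<in>{1..<s}. Kn n s l) + Ks + exp (t / \<sigma>) * (\<Sum>l=s+1..?m. Kn n s l)"
        by (simp add: c_def sum_distrib_left)
      finally have sum_c: "(\<Sum>l=1..?m. c l) = \<dots>" .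
      have "{..<s} = insert 0 {1..<s}" using s by auto
      then have sum_K: "(\<Sum>l<s. Kn n s l) = Kn n s 0 + (\<Sum>l\<in>{1..<s}. Kn n s l)"
        by simp
      have B: "D * exit_prob n 0 * B = exp (- t / \<sigma>) * Kn n s 0"
        unfolding K0[symmetric, of s] using t0 by (simp add: B_def)
      have "D * piece (Suc n) i x = D * exit_prob n 0 * B + (\<Sum>l=1..?m. c l)"
        unfolding D_def piece_Suc_gt_1[OF n False s(1) t] B[unfolded D_def] sum_c sum_K Ks_def
        by (simp only: distrib_left ac_simps)
      then show "D * piece (Suc n) i x = D * exit_prob n 0 * B + D * (\<Sum>l=1..?m. c l / D)"
        using D by (simp add: sum_divide_distrib[symmetric])
    qed
  qed
qed

end

section \<open>The first exit time and the one-step equation\<close>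
lemma first_exit_time_eq_iff:
  assumes "n > 0"
  shows "first_exit_time h x z = enat n \<longleftrightarrow>
    h \<le> lindley x z n \<and> (\<forall>k. 0 < k \<and> k < n \<longrightarrow> lindley x z k < h)"
proof -
  let ?S = "{n. 0 < n \<and> h \<le> lindley x z n}"
  show ?thesis
  proof (intro iffI conjI allI impI)
    assume e: "first_exit_time h x z = enat n"
    have "enat ` ?S \<noteq> {}"
      using e by (auto simp: first_exit_time_def Inf_enat_def split: if_splits)
    then have "first_exit_time h x z \<in> enat ` ?S"
      unfolding first_exit_time_def by (metis (no_types, lifting) equals0I wellorder_InfI)
    then show "h \<le> lindley x z n" using e by auto
    fix k assume k: "0 < k \<and> k < n"
    show "lindley x z k < h"
    proof (rule ccontr)
      assume "\<not> lindley x z k < h"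
      then have "first_exit_time h x z \<le> enat k"
        unfolding first_exit_time_def using k by (intro INF_lower) auto
      then show False using e k by simp
    qed
  next
    assume r: "h \<le> lindley x z n \<and> (\<forall>k. 0 < k \<and> k < n \<longrightarrow> lindley x z k < h)"
    show "first_exit_time h x z = enat n"
      unfolding first_exit_time_def
    proof (rule antisym)
      show "(INF n\<in>?S. enat n) \<le> enat n" using r assms by (intro INF_lower) auto
      show "enat n \<le> (INF n\<in>?S. enat n)"
        using r by (intro INF_greatest) (auto simp: not_less[symmetric])
    qed
  qed
qed

lemma lindley_Suc_shift: "lindley x z (Suc n) = lindley (max 0 (x + z 1)) (\<lambda>k. z (Suc k)) n"
  by (induction n) auto

lemma lindley_cong: "(\<And>k. 1 \<le> k \<Longrightarrow> z k = z' k) \<Longrightarrow> lindley x z n = lindley x z' n"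
  by (induction n) auto

lemma first_exit_time_cong:
  "(\<And>k. 1 \<le> k \<Longrightarrow> z k = z' k) \<Longrightarrow> first_exit_time h x z = first_exit_time h x z'"
  unfolding first_exit_time_def by (simp cong: lindley_cong)

lemma first_exit_time_Suc:
  assumes "n > 0"
  shows "first_exit_time h x z = enat (Suc n) \<longleftrightarrow>
    max 0 (x + z 1) < h \<and> first_exit_time h (max 0 (x + z 1)) (\<lambda>k. z (Suc k)) = enat n"
proof -
  have "(\<forall>k. 0 < k \<and> k < Suc n \<longrightarrow> lindley x z k < h) \<longleftrightarrow>
    (\<forall>k. k < n \<longrightarrow> lindley x z (Suc k) < h)"
    by (metis Suc_less_eq gr0_implies_Suc zero_less_Suc)
  also have "\<dots> \<longleftrightarrow> lindley x z (Suc 0) < h \<and> (\<forall>k. 0 < k \<and> k < n \<longrightarrow> lindley x z (Suc k) < h)"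
    using assms by (metis gr_zeroI)
  finally show ?thesis
    unfolding first_exit_time_eq_iff[OF assms] first_exit_time_eq_iff[OF zero_less_Suc]
      lindley_Suc_shift by auto
qed

lemma measurable_lindley [measurable (raw)]:
  assumes [measurable]: "X \<in> borel_measurable M" "\<And>k. 1 \<le> k \<Longrightarrow> Y k \<in> borel_measurable M"
  shows "(\<lambda>\<omega>. lindley (X \<omega>) (\<lambda>k. Y k \<omega>) n) \<in> borel_measurable M"
proof (induction n)
  case (Suc n)
  note [measurable] = Suc
  have [measurable]: "Y (Suc n) \<in> borel_measurable M" by (rule assms) simp
  show ?case by simp
qed simp

lemma measurable_first_exit_time:
  assumes "n > 0" and XY: "X \<in> borel_measurable M" "\<And>k. 1 \<le> k \<Longrightarrow> Y k \<in> borel_measurable M"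
  shows "Measurable.pred M (\<lambda>\<omega>. first_exit_time h (X \<omega>) (\<lambda>k. Y k \<omega>) = enat n)"
proof -
  have [measurable]: "(\<lambda>\<omega>. lindley (X \<omega>) (\<lambda>k. Y k \<omega>) k) \<in> borel_measurable M" for k
    by (intro measurable_lindley XY)
  show ?thesis unfolding first_exit_time_eq_iff[OF assms(1)] by measurable
qed

lemma nn_integral_shift:
  fixes f :: "real \<Rightarrow> ennreal"
  assumes "f \<in> borel_measurable borel"
  shows "(\<integral>\<^sup>+z. f z \<partial>lborel) = (\<integral>\<^sup>+y. f (y - x) \<partial>lborel)"
  using nn_integral_real_affine[OF assms, of 1 "- x"] by simp

context lindley_laplace
begin

lemma laplace_density_nonneg: "0 \<le> laplace_density \<mu> \<sigma> z"
  using sigma_pos by (simp add: laplace_density_def)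

lemma measurable_laplace_density [measurable]: "laplace_density \<mu> \<sigma> \<in> borel_measurable borel"
  unfolding laplace_density_def[abs_def] by measurable

text \<open>
  Induction on \<open>n\<close>. After the first step the process starts afresh from \<open>max 0 (x + Z (m + 1))\<close> with the
  increments \<open>Z (m + 2), Z (m + 3), \<dots>\<close>, so the starting index \<open>m\<close> has to vary in the induction.
  The first increment is independent of the sequence of the later ones, so the joint law is a
  product measure, and the probability of the event is the integral of the probabilities of its
  sections. The induction hypothesis evaluates these.
\<close>
lemma first_exit_law:
  fixes Z :: "nat \<Rightarrow> 'a \<Rightarrow> real"
  assumes "prob_space M"
    and ind: "prob_space.indep_vars M (\<lambda>_. borel) Z {1..}"
    and distr: "\<And>k. k \<ge> 1 \<Longrightarrow> distributed M lborel (Z k) (laplace_density \<mu> \<sigma>)"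
    and n: "n > 0" and x: "0 \<le> x" "x < h"
  shows "measure M {\<omega> \<in> space M. first_exit_time h x (\<lambda>k. Z (m + k) \<omega>) = enat n} = exit_prob n x"
proof -
  interpret prob_space M by fact
  have Z[measurable]: "Z k \<in> borel_measurable M" if "1 \<le> k" for k
    using distributed_measurable[OF distr[OF that]] by simp
  show ?thesis
    using n x
  proof (induction n arbitrary: m x rule: nat_induct_non_zero)
    case 1
    let ?X = "Z (m + 1)"
    have "{\<omega> \<in> space M. first_exit_time h x (\<lambda>k. Z (m + k) \<omega>) = enat 1} = ?X -` {h - x..} \<inter> space M"
      using h_pos by (auto simp: first_exit_time_eq_iff max_def split: if_splits)
    then have "emeasure M {\<omega> \<in> space M. first_exit_time h x (\<lambda>k. Z (m + k) \<omega>) = enat 1}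
        = (\<integral>\<^sup>+z. ennreal (laplace_density \<mu> \<sigma> z) * indicator {h - x..} z \<partial>lborel)"
      using distributed_emeasure[OF distr[of "m + 1"], of "{h - x..}"] by simp
    also have "\<dots> = (\<integral>\<^sup>+y. ennreal (laplace_density \<mu> \<sigma> (y - x)) * indicator {h..} y \<partial>lborel)"
      by (subst nn_integral_shift[where x=x]) (auto intro!: nn_integral_cong simp: indicator_def)
    also have "\<dots> = exp ((x + \<mu> - h) / \<sigma>) / 2"
      by (rule nn_integral_has_integral_lebesgue'[OF laplace_density_nonneg laplace_mass_above_h]) fact
    finally show ?case
      using exit_prob_1[OF 1] by (simp add: measure_def)
  next
    case (Suc n)
    \<comment> \<open>the probability of exit after \<open>n\<close> more steps, as a function of the position \<open>y\<close> before
      the reflection at \<open>0\<close>\<close>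
    define g where "g y = (if y < h then exit_prob n (max 0 y) else 0)" for y
    \<comment> \<open>the first increment is kept as a one-entry family, as both independent variables are to
      have the same type\<close>
    let ?B = "{Suc (Suc m)..}"
    let ?Q = "PiM {Suc m} (\<lambda>_. borel :: real measure)" and ?P = "PiM ?B (\<lambda>_. borel :: real measure)"
    let ?X = "\<lambda>\<omega>. \<lambda>i\<in>{Suc m}. Z i \<omega>" and ?Y = "\<lambda>\<omega>. \<lambda>i\<in>?B. Z i \<omega>"
    let ?A = "{p \<in> space (?Q \<Otimes>\<^sub>M ?P). max 0 (x + fst p (Suc m)) < h \<and>
      first_exit_time h (max 0 (x + fst p (Suc m))) (\<lambda>k. snd p (Suc m + k)) = enat n}"
    have [measurable]: "(\<lambda>p. fst p (Suc m)) \<in> borel_measurable (?Q \<Otimes>\<^sub>M ?P)"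
      by (rule measurable_compose[OF measurable_fst measurable_component_singleton]) simp
    have [measurable]: "Measurable.pred (?Q \<Otimes>\<^sub>M ?P)
        (\<lambda>p. first_exit_time h (max 0 (x + fst p (Suc m))) (\<lambda>k. snd p (Suc m + k)) = enat n)"
      by (intro measurable_first_exit_time Suc.hyps)
         (auto intro!: measurable_compose[OF measurable_snd measurable_component_singleton])
    have A: "?A \<in> sets (?Q \<Otimes>\<^sub>M ?P)" by measurable
    have X: "?X \<in> measurable M ?Q" and Y: "?Y \<in> measurable M ?P"
      by (intro measurable_restrict Z; simp)+
    have "indep_var ?Q ?X ?P ?Y"
      by (rule indep_var_restrict[OF ind]) auto
    then have pair: "distr M ?Q ?X \<Otimes>\<^sub>M distr M ?P ?Y = distr M (?Q \<Otimes>\<^sub>M ?P) (\<lambda>\<omega>. (?X \<omega>, ?Y \<omega>))"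
      by (simp add: indep_var_distribution_eq)
    interpret Y: prob_space "distr M ?P ?Y" by (rule prob_space_distr[OF Y])
    have "sets (?Q \<Otimes>\<^sub>M distr M ?P ?Y) = sets (?Q \<Otimes>\<^sub>M ?P)"
      "sets (distr M ?Q ?X \<Otimes>\<^sub>M distr M ?P ?Y) = sets (?Q \<Otimes>\<^sub>M ?P)"
      by (intro sets_pair_measure_cong; simp)+
    then have A': "?A \<in> sets (?Q \<Otimes>\<^sub>M distr M ?P ?Y)" "?A \<in> sets (distr M ?Q ?X \<Otimes>\<^sub>M distr M ?P ?Y)"
      using A by (simp_all only:)
    have section_eq: "emeasure (distr M ?P ?Y) (Pair f -` ?A) = ennreal (g (x + f (Suc m)))"
      if f: "f \<in> space ?Q" for f
    proof (cases "x + f (Suc m) < h")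
      case False
      then have "Pair f -` ?A = {}" by (auto simp: max_def split: if_splits)
      then show ?thesis using False by (simp add: g_def)
    next
      case True
      define y where "y = max 0 (x + f (Suc m))"
      have lt: "0 \<le> y" "y < h" using True h_pos by (simp_all add: y_def)
      have "Pair f -` ?A \<in> sets ?P" by (rule sets_Pair1[OF A])
      then have "emeasure (distr M ?P ?Y) (Pair f -` ?A) = emeasure M (?Y -` (Pair f -` ?A) \<inter> space M)"
        by (rule emeasure_distr[OF Y])
      also have "?Y -` (Pair f -` ?A) \<inter> space M =
          {\<omega> \<in> space M. first_exit_time h y (\<lambda>k. Z (Suc m + k) \<omega>) = enat n}"
      proof -
        have "first_exit_time h y (\<lambda>k. ?Y \<omega> (Suc m + k)) = first_exit_time h y (\<lambda>k. Z (Suc m + k) \<omega>)" for \<omega>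
          by (rule first_exit_time_cong) auto
        then show ?thesis
          using lt f True by (auto simp: space_pair_measure space_PiM y_def[symmetric])
      qed
      also have "emeasure M \<dots> = ennreal (exit_prob n y)"
        using Suc.IH[OF lt, of "Suc m"] by (simp add: emeasure_eq_measure)
      also have "exit_prob n y = g (x + f (Suc m))" using True by (simp add: g_def y_def)
      finally show ?thesis .
    qed
    \<comment> \<open>positivity and measurability of the explicit formula come from its meaning as a probability\<close>
    have g_nonneg: "0 \<le> g y" for y
    proof (cases "y < h")
      case True
      then have "exit_prob n (max 0 y) = measure M {\<omega> \<in> space M. first_exit_time h (max 0 y) (\<lambda>k. Z (m + k) \<omega>) = enat n}"
        using h_pos by (intro Suc.IH[symmetric]) auto
      then show ?thesis using True by (simp add: g_def)
    qed (simp add: g_def)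
    have g_meas: "(\<lambda>z. ennreal (g (x + z))) \<in> borel_measurable borel"
    proof -
      have c: "(\<lambda>z. \<lambda>i\<in>{Suc m}. z) \<in> measurable borel ?Q"
        by (intro measurable_restrict) simp
      have "(\<lambda>f. emeasure (distr M ?P ?Y) (Pair f -` ?A)) \<in> borel_measurable ?Q"
        by (rule Y.measurable_emeasure_Pair[OF A'(1)])
      from measurable_compose[OF c this]
      have "(\<lambda>z. emeasure (distr M ?P ?Y) (Pair (\<lambda>i\<in>{Suc m}. z) -` ?A)) \<in> borel_measurable borel" .
      moreover have "emeasure (distr M ?P ?Y) (Pair (\<lambda>i\<in>{Suc m}. z) -` ?A) = ennreal (g (x + z))" for z
        using section_eq[of "\<lambda>i\<in>{Suc m}. z"] measurable_space[OF c, of z] by simp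
      ultimately show ?thesis by (simp only:)
    qed
    have g_meas'[measurable]: "g \<in> borel_measurable borel"
    proof -
      have "(\<lambda>y. enn2real (ennreal (g (x + (y - x))))) \<in> borel_measurable borel"
        by (intro borel_measurable_enn2real measurable_compose[OF _ g_meas]) simp
      then show ?thesis using g_nonneg by simp
    qed
    have I: "((\<lambda>y. laplace_density \<mu> \<sigma> (y - x) * g y) has_integral exit_prob (Suc n) x) UNIV"
      using exit_prob_Suc[OF Suc.hyps Suc.prems] by (simp only: g_def)
    have comp: "(\<lambda>f. f (Suc m)) \<in> measurable ?Q borel"
      by (rule measurable_component_singleton) simp
    have event: "{\<omega> \<in> space M. first_exit_time h x (\<lambda>k. Z (m + k) \<omega>) = enat (Suc n)}
        = (\<lambda>\<omega>. (?X \<omega>, ?Y \<omega>)) -` ?A \<inter> space M"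
    proof -
      have "first_exit_time h y (\<lambda>k. ?Y \<omega> (Suc m + k)) = first_exit_time h y (\<lambda>k. Z (Suc m + k) \<omega>)" for \<omega> y
        by (rule first_exit_time_cong) auto
      then show ?thesis
        unfolding first_exit_time_Suc[OF Suc.hyps] by (auto simp: space_pair_measure space_PiM)
    qed
    have "emeasure M {\<omega> \<in> space M. first_exit_time h x (\<lambda>k. Z (m + k) \<omega>) = enat (Suc n)}
        = emeasure (distr M ?Q ?X \<Otimes>\<^sub>M distr M ?P ?Y) ?A"
      unfolding event pair
      by (rule emeasure_distr[symmetric]) (intro measurable_Pair X Y, rule A)
    also have "\<dots> = (\<integral>\<^sup>+f. emeasure (distr M ?P ?Y) (Pair f -` ?A) \<partial>distr M ?Q ?X)"
      by (rule Y.emeasure_pair_measure_alt[OF A'(2)])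
    also have "\<dots> = (\<integral>\<^sup>+f. ennreal (g (x + f (Suc m))) \<partial>distr M ?Q ?X)"
      by (intro nn_integral_cong section_eq) simp
    also have "\<dots> = (\<integral>\<^sup>+\<omega>. ennreal (g (x + Z (Suc m) \<omega>)) \<partial>M)"
      by (subst nn_integral_distr[OF X]) (use measurable_compose[OF comp g_meas] in simp_all)
    also have "\<dots> = (\<integral>\<^sup>+z. ennreal (laplace_density \<mu> \<sigma> z) * ennreal (g (x + z)) \<partial>lborel)"
      using distributed_nn_integral[OF distr[of "Suc m"], of "\<lambda>z. ennreal (g (x + z))"] g_meas by simp
    also have "\<dots> = (\<integral>\<^sup>+y. ennreal (laplace_density \<mu> \<sigma> (y - x)) * ennreal (g y) \<partial>lborel)"
      by (subst nn_integral_shift[where x=x]) (use g_meas in simp_all)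
    also have "\<dots> = (\<integral>\<^sup>+y. ennreal (laplace_density \<mu> \<sigma> (y - x) * g y) \<partial>lborel)"
      using g_nonneg laplace_density_nonneg by (simp add: ennreal_mult)
    also have "\<dots> = ennreal (exit_prob (Suc n) x)"
      using g_nonneg laplace_density_nonneg by (intro nn_integral_has_integral_lborel I) auto
    finally have "emeasure M {\<omega> \<in> space M. first_exit_time h x (\<lambda>k. Z (m + k) \<omega>) = enat (Suc n)}
        = ennreal (exit_prob (Suc n) x)" .
    moreover have "0 \<le> exit_prob (Suc n) x"
      by (rule has_integral_nonneg[OF I]) (use g_nonneg laplace_density_nonneg in auto)
    ultimately show ?case by (simp add: measure_def)
  qed
qed

end

theorem theorem4p3:
  fixes M :: "'a measure" and Z :: "nat \<Rightarrow> 'a \<Rightarrow> real"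
    and \<mu> \<sigma> h x :: real and n :: nat
  assumes "prob_space M"
    and "\<sigma> > 0" and "\<mu> < 0" and "h > 0"
    and "prob_space.indep_vars M (\<lambda>_. borel) Z {1..}"
    and "\<And>k. k \<ge> 1 \<Longrightarrow> distributed M lborel (Z k) (laplace_density \<mu> \<sigma>)"
    and "n > 0" and "0 \<le> x" and "x < h"
  shows "measure M {\<omega> \<in> space M. first_exit_time h x (\<lambda>k. Z k \<omega>) = enat n}
           = (\<Sum>i=1..hn \<mu> h n. P_piece \<mu> \<sigma> h n i x)"
proof -
  interpret lindley_laplace \<mu> \<sigma> h by unfold_locales fact+
  from first_exit_law[OF assms(1,5-9), of 0] show ?thesis by (simp add: exit_prob_def)
qed

end
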